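(* Let $d\ge2$ and let $V:\mathbb R^d\to\mathbb R$ be continuously differentiable with uniformly bounded derivatives. Let $\mathcal V(\mu)=\int_{\mathbb R^d}V(x)\,d\mu(x)$ for $\mu\in\mathcal P_2(\mathbb R^d)$. Then $$|\partial^-\mathcal V|_{SW}(\mu)=\sqrt d\,|\partial\mathcal V|_W(\mu)\qquad\text{for each }\mu\in\mathcal P_2(\mathbb R^d).$$
   Context: $\mathcal P_2(\mathbb R^d)$ is the set of Borel probability measures on $\mathbb R^d$ with finite second moment, $W$ the quadratic Wasserstein distance, $\sigma$ the uniform probability measure on $\mathbb S^{d-1}$. For $\theta\in\mathbb S^{d-1}$, $\hat\mu^\theta$ is the pushforward of $\mu$ under $x\mapsto x\cdot\theta$, and $SW^2(\mu,\nu)=\int_{\mathbb S^{d-1}}W^2(\hat\mu^\theta,\hat\nu^\theta)\,d\sigma(\theta)$. Metric slope of $\mathcal E$ with respect to a metric $m$: $|\partial\mathcal E|_m(u)=\limsup_{v\to u\text{ in }m}\frac{[\mathcal E(u)-\mathcal E(v)]_+}{m(u,v)}$. Relaxed slope: $|\partial^-\mathcal V|_m(\mu)=\inf\{\liminf_{k\to\infty}|\partial\mathcal V|_m(\mu_k):\ \mu_k\rightharpoonup\mu\text{ narrowly and }\sup_k\max\{m(\mu,\mu_k),\mathcal V(\mu_k)\}<\infty\}$. Narrow convergence means convergence against bounded continuous functions. *)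

theory Defs
  imports "HOL-Probability.Probability"
begin

definition P2 :: "'a::euclidean_space measure set" where
  "P2 = {\<mu>. prob_space \<mu> \<and> sets \<mu> = sets borel \<and> integrable \<mu> (\<lambda>x. (norm x)\<^sup>2)}"

definition couplings ::
    "'a::euclidean_space measure \<Rightarrow> 'a measure \<Rightarrow> ('a \<times> 'a) measure set" where
  "couplings \<mu> \<nu> =
     {\<pi>. sets \<pi> = sets borel \<and> distr \<pi> borel fst = \<mu> \<and> distr \<pi> borel snd = \<nu>}"

(* On P2 the infimum is finite (bounded by the product coupling), so enn2real, which sends
   infinity to 0, loses nothing there.  The same applies to SW below. *)
definition W :: "'a::euclidean_space measure \<Rightarrow> 'a measure \<Rightarrow> real" where
  "W \<mu> \<nu> =
     sqrt (enn2real (INF \<pi>\<in>couplings \<mu> \<nu>. \<integral>\<^sup>+z. ennreal ((dist (fst z) (snd z))\<^sup>2) \<partial>\<pi>))"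

(* The law of x / |x| for x uniform in the unit ball, i.e. the normalised surface measure of the
   unit sphere, carried as a Borel measure on the ambient space.  The centre of the ball, where
   x / |x| is 0 by convention, is a null set; see the lemmas sphere_unif_prob_space, sphere_unif_sphere and
   sphere_unif_rotation_invariant. *)
definition sphere_unif :: "'a::euclidean_space measure" where
  "sphere_unif = distr (uniform_measure lborel (ball 0 1)) borel (\<lambda>x. x /\<^sub>R norm x)"

definition proj :: "'a::euclidean_space \<Rightarrow> 'a measure \<Rightarrow> real measure" where
  "proj \<theta> \<mu> = distr \<mu> borel (\<lambda>x. x \<bullet> \<theta>)"

definition SW :: "'a::euclidean_space measure \<Rightarrow> 'a measure \<Rightarrow> real" where
  "SW \<mu> \<nu> =
     sqrt (enn2real (\<integral>\<^sup>+\<theta>. ennreal ((W (proj \<theta> \<mu>) (proj \<theta> \<nu>))\<^sup>2) \<partial>sphere_unif))"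

(* The filter of punctured m-neighbourhoods of u within S. *)
definition at_metric :: "'s set \<Rightarrow> ('s \<Rightarrow> 's \<Rightarrow> real) \<Rightarrow> 's \<Rightarrow> 's filter" where
  "at_metric S m u = (INF e\<in>{0<..}. principal {v \<in> S. v \<noteq> u \<and> m u v < e})"

(* In ennreal the limsup along the trivial filter is 0, the usual convention at isolated points. *)
definition metric_slope ::
    "'s set \<Rightarrow> ('s \<Rightarrow> 's \<Rightarrow> real) \<Rightarrow> ('s \<Rightarrow> real) \<Rightarrow> 's \<Rightarrow> ennreal" where
  "metric_slope S m E u =
     Limsup (at_metric S m u) (\<lambda>v. ennreal (max 0 (E u - E v) / m u v))"

definition narrowly_conv ::
    "(nat \<Rightarrow> 'a::euclidean_space measure) \<Rightarrow> 'a measure \<Rightarrow> bool" where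
  "narrowly_conv \<mu>s \<mu> \<longleftrightarrow>
     (\<forall>f :: 'a \<Rightarrow> real. continuous_on UNIV f \<and> bounded (range f) \<longrightarrow>
        (\<lambda>k. integral\<^sup>L (\<mu>s k) f) \<longlonglongrightarrow> integral\<^sup>L \<mu> f)"

definition relaxed_slope ::
    "('a::euclidean_space measure \<Rightarrow> 'a measure \<Rightarrow> real) \<Rightarrow> ('a measure \<Rightarrow> real)
       \<Rightarrow> 'a measure \<Rightarrow> ennreal" where
  "relaxed_slope m E \<mu> =
     Inf {liminf (\<lambda>k. metric_slope P2 m E (\<mu>s k)) | \<mu>s.
            (\<forall>k. \<mu>s k \<in> P2) \<and> narrowly_conv \<mu>s \<mu> \<and>
            bdd_above (range (\<lambda>k. max (m \<mu> (\<mu>s k)) (E (\<mu>s k))))}"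

definition potential_energy ::
    "('a::euclidean_space \<Rightarrow> real) \<Rightarrow> 'a measure \<Rightarrow> real" where
  "potential_energy V \<mu> = (\<integral>x. V x \<partial>\<mu>)"

lemma sphere_unif_prob_space: "prob_space (sphere_unif :: 'a::euclidean_space measure)"
proof -
  have "emeasure lborel (ball (0::'a) 1) \<noteq> 0"
    using content_ball_pos[of 1 "0::'a"] by (auto simp: measure_def)
  then have "prob_space (uniform_measure lborel (ball (0::'a) 1))"
    using emeasure_lborel_ball_finite[of "0::'a" 1]
    by (intro prob_space_uniform_measure) auto
  then show ?thesis
    unfolding sphere_unif_def by (rule prob_space.prob_space_distr) measurable
qed

lemma sphere_unif_sphere: "AE \<theta> in (sphere_unif :: 'a::euclidean_space measure). \<theta> \<in> sphere 0 1"
proof -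
  have "AE x in lborel. x \<noteq> (0::'a)" by (rule AE_lborel_singleton)
  then have "AE x in uniform_measure lborel (ball (0::'a) 1). x \<noteq> 0"
    by (intro AE_uniform_measureI) auto
  then have "AE x in uniform_measure lborel (ball (0::'a) 1). x /\<^sub>R norm x \<in> sphere 0 1"
    by eventually_elim (simp add: field_simps)
  then show ?thesis
    unfolding sphere_unif_def by (subst AE_distr_iff) auto
qed

(* The sort wellorder is inherited from measure_orthogonal_image. *)
lemma sphere_unif_rotation_invariant:
  fixes f :: "real ^ 'n::{finite,wellorder} \<Rightarrow> real ^ 'n::{finite,wellorder}"
  assumes f: "orthogonal_transformation f"
  shows "distr sphere_unif borel f = sphere_unif"
proof -
  have lin: "linear f" and nf: "norm (f x) = norm x" for x
    using f by (auto simp: orthogonal_transformation)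
  have [measurable]: "f \<in> borel_measurable borel"
    using lin by (intro borel_measurable_continuous_onI linear_continuous_on linear_conv_bounded_linear[THEN iffD1])
  have inj: "inj f" and surj: "surj f"
    using f orthogonal_transformation_inj orthogonal_transformation_surj by blast+
  have inv_f: "orthogonal_transformation (inv f)"
    using f by (rule orthogonal_transformation_inv)
  let ?B = "ball (0::real^'n::{finite,wellorder}) 1"
  have vol: "emeasure lborel (?B \<inter> f -` A) = emeasure lborel (?B \<inter> A)" if A: "A \<in> sets borel" for A
  proof -
    have *: "?B \<inter> f -` A = inv f ` (?B \<inter> A)"
    proof -
      have "bij f" using inj surj by (simp add: bij_def)
      then have "inv f ` (?B \<inter> A) = f -` (?B \<inter> A)"
        by (rule bij_vimage_eq_inv_image[symmetric])
      also have "\<dots> = ?B \<inter> f -` A" by (auto simp: nf)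
      finally show ?thesis by simp
    qed
    have fin: "emeasure lborel S < \<infinity>" if "S \<subseteq> ?B" for S
      using emeasure_mono[OF that, of lborel] emeasure_lborel_ball_finite[of "0::real^'n::{finite,wellorder}" 1]
      by (simp add: le_less_trans)
    have lm: "?B \<inter> A \<in> lmeasurable"
      using A fin[of "?B \<inter> A"] by (intro fmeasurableI) auto
    have mA: "f -` A \<in> sets borel"
      using measurable_sets[of f borel borel A] A by simp
    have "measure lebesgue (inv f ` (?B \<inter> A)) = measure lebesgue (?B \<inter> A)"
      using inv_f lm by (rule measure_orthogonal_image)
    then have "measure lborel (?B \<inter> f -` A) = measure lborel (?B \<inter> A)"
      using A mA by (simp add: *[symmetric] measure_completion)
    then show ?thesis
      using fin[of "?B \<inter> f -` A"] fin[of "?B \<inter> A"]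
      by (simp add: emeasure_eq_ennreal_measure)
  qed
  have "distr (uniform_measure lborel ?B) borel f = uniform_measure lborel ?B"
  proof (rule measure_eqI)
    fix A assume "A \<in> sets (distr (uniform_measure lborel ?B) borel f)"
    then have A: "A \<in> sets borel" by simp
    moreover have "f -` A \<in> sets borel"
      using measurable_sets[of f borel borel A] A by simp
    ultimately show "emeasure (distr (uniform_measure lborel ?B) borel f) A
        = emeasure (uniform_measure lborel ?B) A"
      by (simp add: emeasure_distr vol)
  qed simp
  moreover have "f (x /\<^sub>R norm x) = f x /\<^sub>R norm (f x)" for x
    using lin by (simp add: linear_scale nf)
  then have "distr sphere_unif borel f
      = distr (distr (uniform_measure lborel ?B) borel f) borel (\<lambda>x. x /\<^sub>R norm x)"
    unfolding sphere_unif_def by (simp add: distr_distr comp_def)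
  ultimately show ?thesis by (simp add: sphere_unif_def)
qed

end

theory Submission
  imports Defs
begin

text \<open>
  Write \<open>g\<close> for the gradient of \<open>V\<close> and \<open>N \<mu>\<close> for the norm of \<open>g\<close> in \<open>L\<^sup>2(\<mu>)\<close>; then \<open>N \<mu>\<close> is the \<open>W\<close>-slope at
  \<open>\<mu>\<close>.  Since \<open>\<surd>d SW \<le> W\<close>, pushing \<open>\<mu>\<close> along \<open>- g\<close> shows that the \<open>SW\<close>-slope is at least \<open>\<surd>d N \<mu>\<close> at every
  \<open>\<mu>\<close>, and \<open>N\<close> is continuous under narrow convergence.  It remains to see that the \<open>SW\<close>-slope equals
  \<open>\<surd>d N \<mu>\<close> at finitely supported \<open>\<mu>\<close>, which are narrowly dense.  For almost every \<open>\<theta>\<close> the atoms have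
  distinct projections; the one-dimensional functions that near \<open>x \<bullet> \<theta>\<close> equal \<open>V x + d (g x \<bullet> \<theta>) (z - x \<bullet> \<theta>)\<close>
  average over \<open>\<theta>\<close> to a function agreeing with \<open>V\<close> to first order at the atoms, and weak Kantorovich
  duality on each line bounds their increments by \<open>SW\<close>.  The remainder is of order \<open>\<epsilon> m + K m\<^sup>2\<close> in the
  distance \<open>m\<close> to the support, and the second moment of \<open>m\<close> is at most a constant times \<open>SW\<^sup>2\<close>.
\<close>

section \<open>Couplings and the Wasserstein distance\<close>

text \<open>A potential on the line \<open>\<real>\<theta>\<close> sees a point only through
  \<open>x \<bullet> \<theta>\<close>, whereas the first-order data \<open>V x\<close> and
  \<open>g x\<close> depend on \<open>x\<close> itself. They can be transferred to the line only if
  the projection identifies the point, which for finitely many atoms holds with a positive gap and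
  for diffuse \<open>\<mu>\<close> fails. This is why the upper bound is taken at finite supports
  and why the relaxed slope, free to choose its sequence, is the right object. The factor
  \<open>sqrt d\<close> comes from isotropy: \<open>(w \<bullet> \<theta>)\<^sup>2\<close> has mean
  \<open>(norm w)\<^sup>2 / d\<close>. To recover \<open>g x\<close> the slopes on the lines carry a
  factor \<open>d\<close>; their squares then average to \<open>d * (norm (g x))\<^sup>2\<close>.
  Duality for quadratic cost bounds increments by squared distances only. It is therefore applied to
  a family of potentials with a free Young weight \<open>l\<close>, and optimising \<open>l\<close>
  at the end produces the term linear in the distance. No optimal coupling is needed.\<close>

lemma P2D:
  assumes "\<mu> \<in> P2"
  shows "prob_space \<mu>" "sets \<mu> = sets borel" "space \<mu> = UNIV" "integrable \<mu> (\<lambda>x. (norm x)\<^sup>2)"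
  using assms sets_eq_imp_space_eq[of \<mu> borel] by (auto simp: P2_def)

lemma couplingsD:
  assumes "\<pi> \<in> couplings \<mu> \<nu>"
  shows "sets \<pi> = sets borel" "space \<pi> = UNIV" "distr \<pi> borel fst = \<mu>" "distr \<pi> borel snd = \<nu>"
  using assms sets_eq_imp_space_eq[of \<pi> borel] by (auto simp: couplings_def)

lemma couplings_measurable:
  fixes \<mu> \<nu> :: "'a::euclidean_space measure"
  assumes "\<pi> \<in> couplings \<mu> \<nu>"
  shows "fst \<in> borel_measurable \<pi>" "snd \<in> borel_measurable \<pi>"
  unfolding measurable_cong_sets[OF couplingsD(1)[OF assms] refl]
  by (simp_all add: borel_measurable_continuous_onI continuous_on_fst continuous_on_snd)

lemma couplings_prob_space:
  assumes "\<pi> \<in> couplings \<mu> (\<nu> :: 'a::euclidean_space measure)" "prob_space \<mu>"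
  shows "prob_space \<pi>"
proof -
  have [measurable_cong]: "sets \<pi> = sets borel" using couplingsD(1)[OF assms(1)] .
  note [measurable] = couplings_measurable[OF assms(1)]
  show ?thesis
    using assms(2) couplingsD(3)[OF assms(1)]
    by (intro prob_space_distrD[of fst \<pi> borel]) auto
qed

lemma P2_square_integrable_diff:
  fixes f h :: "'b \<Rightarrow> 'a::euclidean_space"
  assumes [measurable]: "f \<in> borel_measurable M" "h \<in> borel_measurable M"
    and "integrable M (\<lambda>x. (norm (f x))\<^sup>2)" "integrable M (\<lambda>x. (norm (h x))\<^sup>2)"
  shows "integrable M (\<lambda>x. (norm (f x - h x))\<^sup>2)"
proof (rule Bochner_Integration.integrable_bound)
  show "integrable M (\<lambda>x. 2 * (norm (f x))\<^sup>2 + 2 * (norm (h x))\<^sup>2)" using assms by auto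
  have "(norm (a - b))\<^sup>2 \<le> 2 * (norm a)\<^sup>2 + 2 * (norm b)\<^sup>2" for a b :: 'a
  proof -
    have "(norm (a - b))\<^sup>2 \<le> (norm a + norm b)\<^sup>2" by (intro power_mono norm_triangle_ineq4) auto
    also have "\<dots> \<le> 2 * (norm a)\<^sup>2 + 2 * (norm b)\<^sup>2"
      using sum_squares_bound[of "norm a" "norm b"] by (simp add: power2_eq_square algebra_simps)
    finally show ?thesis .
  qed
  then show "AE x in M. norm ((norm (f x - h x))\<^sup>2) \<le> norm (2 * (norm (f x))\<^sup>2 + 2 * (norm (h x))\<^sup>2)"
    by (auto intro!: AE_I2 order_trans[OF _ abs_ge_self])
qed measurable

lemma coupling_dist_integrable:
  fixes \<mu> \<nu> :: "'a::euclidean_space measure"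
  assumes \<pi>: "\<pi> \<in> couplings \<mu> \<nu>" and "\<mu> \<in> P2" "\<nu> \<in> P2"
  shows "integrable \<pi> (\<lambda>z. (dist (fst z) (snd z))\<^sup>2)"
proof -
  have [measurable_cong]: "sets \<pi> = sets borel" using couplingsD(1)[OF \<pi>] .
  note [measurable] = couplings_measurable[OF \<pi>]
  have "integrable (distr \<pi> borel fst) (\<lambda>x. (norm x)\<^sup>2)" "integrable (distr \<pi> borel snd) (\<lambda>x. (norm x)\<^sup>2)"
    using assms couplingsD[OF \<pi>] P2D by auto
  then have "integrable \<pi> (\<lambda>z. (norm (fst z))\<^sup>2)" "integrable \<pi> (\<lambda>z. (norm (snd z))\<^sup>2)"
    by (auto simp: integrable_distr_eq)
  then show ?thesis
    unfolding dist_norm by (intro P2_square_integrable_diff) auto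
qed

lemma couplings_nonempty:
  fixes \<mu> \<nu> :: "'a::euclidean_space measure"
  assumes "\<mu> \<in> P2" "\<nu> \<in> P2"
  shows "\<mu> \<Otimes>\<^sub>M \<nu> \<in> couplings \<mu> \<nu>"
proof -
  interpret m: prob_space \<mu> using assms P2D by auto
  interpret n: prob_space \<nu> using assms P2D by auto
  interpret mn: pair_prob_space \<mu> \<nu> ..
  have s: "sets \<mu> = sets borel" "sets \<nu> = sets borel" using assms P2D by auto
  have sp: "sets (\<mu> \<Otimes>\<^sub>M \<nu>) = sets borel"
    using s by (simp add: borel_prod[symmetric] cong: sets_pair_measure_cong)
  have 1: "distr (\<mu> \<Otimes>\<^sub>M \<nu>) borel fst = \<mu>"
    using n.distr_pair_fst[of \<mu>] s distr_cong[OF refl, of borel \<mu> "\<mu> \<Otimes>\<^sub>M \<nu>" fst fst] by simp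
  have 2: "distr (\<mu> \<Otimes>\<^sub>M \<nu>) borel snd = \<nu>"
  proof (rule measure_eqI)
    fix A assume "A \<in> sets (distr (\<mu> \<Otimes>\<^sub>M \<nu>) borel snd)"
    then have A: "A \<in> sets \<nu>" using s by simp
    have [measurable]: "snd \<in> measurable (\<mu> \<Otimes>\<^sub>M \<nu>) borel"
      using s measurable_snd[of \<mu> \<nu>] measurable_cong_sets[of "\<mu> \<Otimes>\<^sub>M \<nu>" "\<mu> \<Otimes>\<^sub>M \<nu>" \<nu> borel] by simp
    have "snd -` A \<inter> space (\<mu> \<Otimes>\<^sub>M \<nu>) = space \<mu> \<times> A"
      using sets.sets_into_space[OF A] by (auto simp: space_pair_measure)
    then show "emeasure (distr (\<mu> \<Otimes>\<^sub>M \<nu>) borel snd) A = emeasure \<nu> A"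
      using A s n.emeasure_pair_measure_Times[OF sets.top[of \<mu>] A] m.emeasure_space_1
      by (simp add: emeasure_distr)
  qed (use s in simp)
  show ?thesis using sp 1 2 by (auto simp: couplings_def)
qed

lemma ennreal_W_squared:
  fixes \<mu> \<nu> :: "'a::euclidean_space measure"
  assumes "\<mu> \<in> P2" "\<nu> \<in> P2"
  shows "ennreal ((W \<mu> \<nu>)\<^sup>2) =
    (INF \<pi>\<in>couplings \<mu> \<nu>. \<integral>\<^sup>+z. ennreal ((dist (fst z) (snd z))\<^sup>2) \<partial>\<pi>)" (is "_ = ?I")
proof -
  note c = couplings_nonempty[OF assms]
  have "?I \<le> (\<integral>\<^sup>+z. ennreal ((dist (fst z) (snd z))\<^sup>2) \<partial>(\<mu> \<Otimes>\<^sub>M \<nu>))"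
    using c by (rule INF_lower)
  also have "\<dots> < \<infinity>"
    using coupling_dist_integrable[OF c assms] by (simp add: nn_integral_eq_integral)
  finally show ?thesis by (simp add: W_def)
qed

lemma W_nonneg [simp]: "0 \<le> W \<mu> \<nu>" by (simp add: W_def)

lemma SW_nonneg [simp]: "0 \<le> SW \<mu> \<nu>" by (simp add: SW_def)

lemma W_le_coupling:
  fixes \<mu> \<nu> :: "'a::euclidean_space measure"
  assumes "\<mu> \<in> P2" "\<nu> \<in> P2" "\<pi> \<in> couplings \<mu> \<nu>"
  shows "(W \<mu> \<nu>)\<^sup>2 \<le> (\<integral>z. (dist (fst z) (snd z))\<^sup>2 \<partial>\<pi>)"
proof -
  have "ennreal ((W \<mu> \<nu>)\<^sup>2) \<le> (\<integral>\<^sup>+z. ennreal ((dist (fst z) (snd z))\<^sup>2) \<partial>\<pi>)"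
    unfolding ennreal_W_squared[OF assms(1,2)] using assms(3) by (rule INF_lower)
  also have "\<dots> = ennreal (\<integral>z. (dist (fst z) (snd z))\<^sup>2 \<partial>\<pi>)"
    using coupling_dist_integrable[OF assms(3,1,2)] by (simp add: nn_integral_eq_integral)
  finally show ?thesis by (simp add: ennreal_le_iff)
qed

lemma le_W_squared:
  fixes \<mu> \<nu> :: "'a::euclidean_space measure"
  assumes "\<mu> \<in> P2" "\<nu> \<in> P2"
    and le: "\<And>\<pi>. \<pi> \<in> couplings \<mu> \<nu> \<Longrightarrow> c \<le> (\<integral>z. (dist (fst z) (snd z))\<^sup>2 \<partial>\<pi>)"
  shows "c \<le> (W \<mu> \<nu>)\<^sup>2"
proof -
  have "ennreal c \<le> (INF \<pi>\<in>couplings \<mu> \<nu>. \<integral>\<^sup>+z. ennreal ((dist (fst z) (snd z))\<^sup>2) \<partial>\<pi>)"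
  proof (rule INF_greatest)
    fix \<pi> assume \<pi>: "\<pi> \<in> couplings \<mu> \<nu>"
    have "ennreal c \<le> ennreal (\<integral>z. (dist (fst z) (snd z))\<^sup>2 \<partial>\<pi>)" using le[OF \<pi>] by (rule ennreal_leI)
    then show "ennreal c \<le> (\<integral>\<^sup>+z. ennreal ((dist (fst z) (snd z))\<^sup>2) \<partial>\<pi>)"
      using coupling_dist_integrable[OF \<pi> assms(1,2)] by (simp add: nn_integral_eq_integral)
  qed
  then show ?thesis unfolding ennreal_W_squared[OF assms(1,2), symmetric] by (simp add: ennreal_le_iff)
qed

text \<open>Integrating the pointwise bound against any coupling gives a left side that depends on
  the marginals only. The bound is required for \<open>\<mu>\<close>-almost every \<open>x\<close>
  because the potentials built from the atoms of \<open>\<mu>\<close> satisfy it only at those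
  atoms.\<close>

lemma W_dual:
  fixes \<mu> \<nu> :: "'a::euclidean_space measure"
  assumes \<mu>: "\<mu> \<in> P2" and \<nu>: "\<nu> \<in> P2"
    and \<phi>: "integrable \<mu> \<phi>" and \<psi>: "integrable \<nu> \<psi>" and "0 < K"
    and le: "AE x in \<mu>. \<forall>y. \<phi> x + \<psi> y \<le> K * (dist x y)\<^sup>2"
  shows "integral\<^sup>L \<mu> \<phi> + integral\<^sup>L \<nu> \<psi> \<le> K * (W \<mu> \<nu>)\<^sup>2"
proof -
  have "(integral\<^sup>L \<mu> \<phi> + integral\<^sup>L \<nu> \<psi>) / K \<le> (W \<mu> \<nu>)\<^sup>2"
  proof (rule le_W_squared[OF \<mu> \<nu>])
    fix \<pi> assume \<pi>: "\<pi> \<in> couplings \<mu> \<nu>"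
    note d = couplingsD[OF \<pi>]
    have [measurable_cong]: "sets \<pi> = sets borel" using d by simp
    note m[measurable] = couplings_measurable[OF \<pi>]
    have f: "integrable (distr \<pi> borel fst) \<phi>" "integrable (distr \<pi> borel snd) \<psi>" using d \<phi> \<psi> by auto
    have [measurable]: "\<phi> \<in> borel_measurable borel" "\<psi> \<in> borel_measurable borel"
      using borel_measurable_integrable[OF f(1)] borel_measurable_integrable[OF f(2)] by auto
    have i: "integrable \<pi> (\<lambda>z. \<phi> (fst z))" "integrable \<pi> (\<lambda>z. \<psi> (snd z))"
      using f by (simp_all add: integrable_distr_eq)
    have "AE x in distr \<pi> borel fst. \<forall>y. \<phi> x + \<psi> y \<le> K * (dist x y)\<^sup>2" unfolding d(3) by (rule le)
    from AE_distrD[OF m(1) this] have ae: "AE z in \<pi>. \<phi> (fst z) + \<psi> (snd z) \<le> K * (dist (fst z) (snd z))\<^sup>2"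
      by auto
    have "integral\<^sup>L \<mu> \<phi> + integral\<^sup>L \<nu> \<psi> = (\<integral>z. \<phi> (fst z) \<partial>\<pi>) + (\<integral>z. \<psi> (snd z) \<partial>\<pi>)"
      using d integral_distr[OF m(1), of \<phi>] integral_distr[OF m(2), of \<psi>] by simp
    also have "\<dots> = (\<integral>z. \<phi> (fst z) + \<psi> (snd z) \<partial>\<pi>)" using i by simp
    also have "\<dots> \<le> (\<integral>z. K * (dist (fst z) (snd z))\<^sup>2 \<partial>\<pi>)"
      using i ae coupling_dist_integrable[OF \<pi> \<mu> \<nu>] by (intro integral_mono_AE) auto
    also have "\<dots> = K * (\<integral>z. (dist (fst z) (snd z))\<^sup>2 \<partial>\<pi>)" by simp
    finally show "(integral\<^sup>L \<mu> \<phi> + integral\<^sup>L \<nu> \<psi>) / K \<le> (\<integral>z. (dist (fst z) (snd z))\<^sup>2 \<partial>\<pi>)"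
      using \<open>0 < K\<close> by (simp add: field_simps)
  qed
  then show ?thesis using \<open>0 < K\<close> by (simp add: field_simps)
qed

lemma proj_P2:
  fixes \<mu> :: "'a::euclidean_space measure"
  assumes "\<mu> \<in> P2"
  shows "proj \<theta> \<mu> \<in> P2"
proof -
  interpret prob_space \<mu> using assms P2D by auto
  have [measurable_cong]: "sets \<mu> = sets borel" using assms P2D by auto
  have "integrable \<mu> (\<lambda>x. (norm (x \<bullet> \<theta>))\<^sup>2)"
  proof (rule Bochner_Integration.integrable_bound)
    show "integrable \<mu> (\<lambda>x. (norm \<theta>)\<^sup>2 * (norm x)\<^sup>2)"
      using P2D(4)[OF assms] by (rule integrable_mult_right)
    show "AE x in \<mu>. norm ((norm (x \<bullet> \<theta>))\<^sup>2) \<le> norm ((norm \<theta>)\<^sup>2 * (norm x)\<^sup>2)"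
      using Cauchy_Schwarz_ineq[of _ \<theta>]
      by (intro AE_I2) (simp add: power2_norm_eq_inner mult.commute)
  qed measurable
  then show ?thesis
    unfolding P2_def proj_def by (auto intro!: prob_space_distr simp: integrable_distr_eq)
qed

lemma distr_P2:
  fixes T :: "'a::euclidean_space \<Rightarrow> 'a"
  assumes \<mu>: "\<mu> \<in> P2" and [measurable]: "T \<in> borel_measurable borel"
    and "integrable \<mu> (\<lambda>x. (norm (T x))\<^sup>2)"
  shows "distr \<mu> borel T \<in> P2"
proof -
  interpret prob_space \<mu> using assms P2D by auto
  have [measurable_cong]: "sets \<mu> = sets borel" using assms P2D by auto
  show ?thesis
    using assms unfolding P2_def by (auto intro!: prob_space_distr simp: integrable_distr_eq)
qed

lemma W_distr_le:
  fixes T :: "'a::euclidean_space \<Rightarrow> 'a"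
  assumes \<mu>: "\<mu> \<in> P2" and [measurable]: "T \<in> borel_measurable borel"
    and T: "integrable \<mu> (\<lambda>x. (norm (T x))\<^sup>2)"
  shows "(W \<mu> (distr \<mu> borel T))\<^sup>2 \<le> (\<integral>x. (dist x (T x))\<^sup>2 \<partial>\<mu>)"
proof -
  have s[measurable_cong]: "sets \<mu> = sets borel" using assms P2D by auto
  have [measurable]: "fst \<in> measurable borel (borel :: 'a measure)" "snd \<in> measurable borel (borel :: 'a measure)"
    by (simp_all add: borel_measurable_continuous_onI continuous_on_fst continuous_on_snd)
  have [measurable]: "(\<lambda>x. (x, T x)) \<in> measurable \<mu> borel"
    by (simp add: borel_prod[symmetric])
  have id: "distr \<mu> borel (\<lambda>x. x) = \<mu>" using distr_id2[of borel \<mu>] s by simp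
  let ?\<pi> = "distr \<mu> borel (\<lambda>x. (x, T x))"
  have "?\<pi> \<in> couplings \<mu> (distr \<mu> borel T)"
    unfolding couplings_def by (auto simp: distr_distr comp_def id)
  from W_le_coupling[OF \<mu> distr_P2[OF assms] this] show ?thesis
    by (simp add: integral_distr)
qed

section \<open>Symmetry and small slabs of the uniform measure on the sphere\<close>

text \<open>A linear isometry commutes with \<open>x /\<^sub>R norm x\<close> and preserves the unit
  ball. Invariance of \<open>lborel\<close> is a hypothesis so that the lemma applies on every
  Euclidean space; it is verified directly for the two maps used below, which already generate
  enough symmetry.\<close>

lemma sphere_unif_linear_isometry:
  fixes f :: "'a::euclidean_space \<Rightarrow> 'a"
  assumes lin: "linear f" and nf: "\<And>x. norm (f x) = norm x" and lb: "distr lborel borel f = lborel"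
  shows "distr sphere_unif borel f = sphere_unif"
proof -
  have [measurable]: "f \<in> borel_measurable borel"
    using lin by (intro borel_measurable_continuous_onI linear_continuous_on linear_conv_bounded_linear[THEN iffD1])
  let ?B = "ball (0::'a) 1"
  have "distr (uniform_measure lborel ?B) borel f = uniform_measure lborel ?B"
  proof (rule measure_eqI)
    fix A assume "A \<in> sets (distr (uniform_measure lborel ?B) borel f)"
    then have A[measurable]: "A \<in> sets borel" by simp
    have fA: "f -` A \<in> sets borel"
      using measurable_sets[of f borel borel A] A by simp
    have "?B \<inter> f -` A = f -` (?B \<inter> A)" by (auto simp: nf)
    moreover have "emeasure lborel (f -` (?B \<inter> A)) = emeasure lborel (?B \<inter> A)"
      using emeasure_distr[of f lborel borel "?B \<inter> A"] by (simp add: lb)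
    ultimately show "emeasure (distr (uniform_measure lborel ?B) borel f) A
        = emeasure (uniform_measure lborel ?B) A"
      using A fA by (simp add: emeasure_distr)
  qed simp
  moreover have "f (x /\<^sub>R norm x) = f x /\<^sub>R norm (f x)" for x
    using lin by (simp add: linear_scale nf)
  then have "distr sphere_unif borel f
      = distr (distr (uniform_measure lborel ?B) borel f) borel (\<lambda>x. x /\<^sub>R norm x)"
    unfolding sphere_unif_def by (simp add: distr_distr comp_def)
  ultimately show ?thesis by (simp add: sphere_unif_def)
qed

lemma sphere_unif_reflect:
  fixes b :: "'a::euclidean_space"
  assumes b: "b \<in> Basis"
  shows "distr sphere_unif borel (\<lambda>x. x - (2 * (x \<bullet> b)) *\<^sub>R b) = sphere_unif" (is "distr _ _ ?f = _")
proof (rule sphere_unif_linear_isometry)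
  show "linear ?f" by (rule linearI) (simp_all add: algebra_simps inner_left_distrib)
  show "norm (?f x) = norm x" for x
    unfolding norm_eq_sqrt_inner using b
    by (simp add: inner_diff_left inner_diff_right inner_commute[of b x] algebra_simps)
  let ?c = "\<lambda>j::'a. if j = b then -1 else (1::real)"
  \<comment> \<open>\<open>?f\<close> is diagonal with entry -1 at \<open>b\<close> and 1 elsewhere,
    the form covered by the affine change of variables for \<open>lborel\<close>.\<close>
  have eq: "(\<lambda>x::'a. 0 + (\<Sum>j\<in>Basis. (?c j * (x \<bullet> j)) *\<^sub>R j)) = ?f"
  proof
    fix x :: 'a
    show "0 + (\<Sum>j\<in>Basis. (?c j * (x \<bullet> j)) *\<^sub>R j) = ?f x"
      by (rule euclidean_eqI) (use b in \<open>auto simp: inner_sum_left inner_Basis inner_diff_left if_distrib sum.delta cong: if_cong\<close>)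
  qed
  have "lborel = density (distr lborel borel ?f) (\<lambda>_. ennreal (\<Prod>j\<in>Basis. \<bar>?c j\<bar>))"
    using lborel_affine_euclidean[of ?c 0] unfolding eq by auto
  also have "(\<Prod>j\<in>Basis. \<bar>?c j\<bar>) = 1" by (intro prod.neutral) auto
  finally show "distr lborel borel ?f = lborel" by (simp add: density_1)
qed

lemma sphere_unif_swap:
  fixes b c :: "'a::euclidean_space"
  assumes bc: "b \<in> Basis" "c \<in> Basis"
  shows "distr sphere_unif borel (\<lambda>x. \<Sum>i\<in>Basis. (x \<bullet> Transposition.transpose b c i) *\<^sub>R i) = sphere_unif"
    (is "distr _ _ ?f = _")
proof (rule sphere_unif_linear_isometry)
  let ?t = "Transposition.transpose b c"
  have tB: "?t i \<in> Basis \<longleftrightarrow> i \<in> Basis" for i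
    using bc by (auto simp: Transposition.transpose_def)
  have bij: "bij_betw ?t Basis Basis"
    by (rule bij_betw_byWitness[where f' = ?t]) (auto simp: tB)
  have fi: "?f x \<bullet> i = x \<bullet> ?t i" if "i \<in> Basis" for x i
    using that by (simp add: inner_sum_left inner_Basis if_distrib sum.delta cong: if_cong)
  show lin: "linear ?f"
    by (rule linearI) (simp_all add: inner_left_distrib scaleR_left_distrib sum.distrib scaleR_sum_right)
  have [measurable]: "?f \<in> borel_measurable borel"
    using lin by (intro borel_measurable_continuous_onI linear_continuous_on linear_conv_bounded_linear[THEN iffD1])
  show "norm (?f x) = norm x" for x
  proof -
    have "?f x \<bullet> ?f x = (\<Sum>i\<in>Basis. (x \<bullet> ?t i) * (x \<bullet> ?t i))"
      by (subst euclidean_inner) (auto simp: fi intro!: sum.cong)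
    also have "\<dots> = (\<Sum>i\<in>Basis. (x \<bullet> i) * (x \<bullet> i))"
      by (rule sum.reindex_bij_betw[OF bij])
    also have "\<dots> = x \<bullet> x" by (rule euclidean_inner[symmetric])
    finally show ?thesis by (simp add: norm_eq_sqrt_inner)
  qed
  \<comment> \<open>Permuting coordinates sends boxes to boxes and only reorders the factors of
    their volume, and \<open>lborel\<close> is determined by its values on boxes.\<close>
  show "distr lborel borel ?f = lborel"
  proof (rule lborel_eqI[symmetric])
    fix l u :: 'a assume le: "\<And>i. i \<in> Basis \<Longrightarrow> l \<bullet> i \<le> u \<bullet> i"
    have "?f -` box l u = box (?f l) (?f u)"
      unfolding box_def by (auto simp: fi) (metis tB Transposition.transpose_involutory)+
    then have "emeasure (distr lborel borel ?f) (box l u) = emeasure lborel (box (?f l) (?f u))"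
      by (simp add: emeasure_distr)
    also have "\<dots> = ennreal (\<Prod>i\<in>Basis. (?f u - ?f l) \<bullet> i)"
      using le tB by (intro emeasure_lborel_box) (auto simp: fi)
    also have "(\<Prod>i\<in>Basis. (?f u - ?f l) \<bullet> i) = (\<Prod>i\<in>Basis. (u - l) \<bullet> ?t i)"
      by (intro prod.cong) (auto simp: fi inner_diff_left)
    also have "\<dots> = (\<Prod>i\<in>Basis. (u - l) \<bullet> i)"
      by (rule prod.reindex_bij_betw[OF bij])
    finally show "emeasure (distr lborel borel ?f) (box l u) = (\<Prod>i\<in>Basis. (u - l) \<bullet> i)" .
  qed simp
qed

lemma sets_sphere_unif [measurable_cong, simp]: "sets sphere_unif = sets borel"
  by (simp add: sphere_unif_def)

lemma space_sphere_unif [simp]: "space sphere_unif = UNIV"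
  by (simp add: sphere_unif_def)

lemma AE_sphere_unif_norm: "AE \<theta> in (sphere_unif :: 'a::euclidean_space measure). norm \<theta> = 1"
  using sphere_unif_sphere by eventually_elim simp

section \<open>Second moments of the uniform measure on the sphere\<close>

lemma integrable_sphere_unif_inner:
  fixes u v :: "'a::euclidean_space"
  shows "integrable sphere_unif (\<lambda>\<theta>. (\<theta> \<bullet> u) * (\<theta> \<bullet> v))"
proof (rule finite_measure.integrable_const_bound)
  show "finite_measure (sphere_unif :: 'a measure)"
    using sphere_unif_prob_space by (rule prob_space.finite_measure)
  show "AE \<theta> in sphere_unif. norm ((\<theta> \<bullet> u) * (\<theta> \<bullet> v)) \<le> norm u * norm v"
    using AE_sphere_unif_norm
  proof eventually_elim
    case (elim \<theta>)
    then show ?case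
      using Cauchy_Schwarz_ineq2[of \<theta> u] Cauchy_Schwarz_ineq2[of \<theta> v]
      by (auto simp: abs_mult intro!: mult_mono)
  qed
qed measurable

text \<open>Reflecting the coordinate \<open>b\<close> flips the sign of the mixed moments, so they
  vanish. Swapping coordinates makes the diagonal moments equal, and they sum to 1 because
  \<open>norm \<theta> = 1\<close> almost surely.\<close>

lemma sphere_unif_inner_Basis:
  fixes b c :: "'a::euclidean_space"
  assumes b: "b \<in> Basis" and c: "c \<in> Basis"
  shows "(\<integral>\<theta>. (\<theta> \<bullet> b) * (\<theta> \<bullet> c) \<partial>sphere_unif) = (if b = c then 1 / DIM('a) else 0)"
proof -
  have inv: "(\<integral>\<theta>. h (f \<theta>) \<partial>sphere_unif) = (\<integral>\<theta>. h \<theta> \<partial>sphere_unif)"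
    if "distr sphere_unif borel f = sphere_unif" "f \<in> borel_measurable borel" "h \<in> borel_measurable borel"
    for f :: "'a \<Rightarrow> 'a" and h :: "'a \<Rightarrow> real"
    using integral_distr[of f sphere_unif borel h] that by simp
  show ?thesis
  proof (cases "b = c")
    case False
    let ?f = "\<lambda>x::'a. x - (2 * (x \<bullet> b)) *\<^sub>R b"
    have "(?f \<theta> \<bullet> b) * (?f \<theta> \<bullet> c) = - ((\<theta> \<bullet> b) * (\<theta> \<bullet> c))" for \<theta>
      using b c False by (simp add: inner_diff_left inner_Basis)
    with inv[OF sphere_unif_reflect[OF b], of "\<lambda>\<theta>. (\<theta> \<bullet> b) * (\<theta> \<bullet> c)"] False show ?thesis by simp
  next
    case True
    let ?q = "\<lambda>b::'a. (\<integral>\<theta>. (\<theta> \<bullet> b) * (\<theta> \<bullet> b) \<partial>sphere_unif)"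
    have q: "?q i = ?q b" if i: "i \<in> Basis" for i
    proof -
      let ?f = "\<lambda>x::'a. \<Sum>j\<in>Basis. (x \<bullet> Transposition.transpose b i j) *\<^sub>R j"
      have "?f \<theta> \<bullet> b = \<theta> \<bullet> i" for \<theta>
        using b by (simp add: inner_sum_left inner_Basis if_distrib sum.delta cong: if_cong)
      with inv[OF sphere_unif_swap[OF b i], of "\<lambda>\<theta>. (\<theta> \<bullet> b) * (\<theta> \<bullet> b)"] show ?thesis by simp
    qed
    have "DIM('a) * ?q b = (\<Sum>i\<in>Basis. ?q i)" using q by simp
    also have "\<dots> = (\<integral>\<theta>. (\<Sum>i\<in>Basis. (\<theta> \<bullet> i) * (\<theta> \<bullet> i)) \<partial>(sphere_unif :: 'a measure))"
      by (simp add: Bochner_Integration.integral_sum integrable_sphere_unif_inner)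
    also have "\<dots> = (\<integral>\<theta>. 1 \<partial>(sphere_unif :: 'a measure))"
    proof (rule integral_cong_AE)
      show "AE \<theta> in (sphere_unif :: 'a measure). (\<Sum>i\<in>Basis. (\<theta> \<bullet> i) * (\<theta> \<bullet> i)) = (1::real)"
        using AE_sphere_unif_norm
      proof eventually_elim
        case (elim \<theta>)
        then show ?case by (simp add: euclidean_inner[of \<theta> \<theta>, symmetric] dot_square_norm)
      qed
    qed measurable
    also have "\<dots> = 1"
      using prob_space.prob_space[OF sphere_unif_prob_space, where ?'a1 = 'a] by simp
    finally show ?thesis using True by (simp add: field_simps)
  qed
qed

text \<open>The source of every factor \<open>DIM('a)\<close> below: the mean of the rank-one maps
  \<open>x \<mapsto> (x \<bullet> \<theta>) \<theta>\<close> is the identity divided by the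
  dimension.\<close>

lemma sphere_unif_inner_inner:
  fixes u v :: "'a::euclidean_space"
  shows "(\<integral>\<theta>. (\<theta> \<bullet> u) * (\<theta> \<bullet> v) \<partial>sphere_unif) = (u \<bullet> v) / DIM('a)"
proof -
  have "(\<integral>\<theta>. (\<theta> \<bullet> u) * (\<theta> \<bullet> v) \<partial>sphere_unif)
      = (\<integral>\<theta>. (\<Sum>b\<in>Basis. \<Sum>c\<in>Basis. ((u \<bullet> b) * (v \<bullet> c)) * ((\<theta> \<bullet> b) * (\<theta> \<bullet> c))) \<partial>sphere_unif)"
    by (subst (1 2) euclidean_inner) (simp add: sum_product algebra_simps)
  also have "\<dots> = (\<Sum>b\<in>Basis. \<Sum>c\<in>Basis. ((u \<bullet> b) * (v \<bullet> c)) * (\<integral>\<theta>. (\<theta> \<bullet> b) * (\<theta> \<bullet> c) \<partial>sphere_unif))"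
    by (simp add: Bochner_Integration.integral_sum integrable_sphere_unif_inner Bochner_Integration.integrable_sum)
  also have "\<dots> = (\<Sum>b\<in>Basis. \<Sum>c\<in>Basis. if b = c then (u \<bullet> b) * (v \<bullet> c) / DIM('a) else 0)"
    by (intro sum.cong refl) (simp add: sphere_unif_inner_Basis)
  also have "\<dots> = (\<Sum>b\<in>Basis. (u \<bullet> b) * (v \<bullet> b) / DIM('a))"
    by (simp add: sum.delta)
  also have "\<dots> = (u \<bullet> v) / DIM('a)"
    by (simp add: euclidean_inner[of u v] sum_divide_distrib)
  finally show ?thesis .
qed

text \<open>Disjoint translates of the slab of width \<open>2c\<close> along its normal all fit into the ball of radius 2.\<close>

lemma measure_slab_le:
  fixes v :: "'a::euclidean_space"
  assumes v: "norm v = 1" and c: "0 < c" and n: "2 * c * real n \<le> 1"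
  shows "real n * measure lborel (ball 0 1 \<inter> {x. \<bar>x \<bullet> v\<bar> < c}) \<le> 2 ^ DIM('a) * measure lborel (ball (0::'a) 1)"
proof -
  let ?A = "ball 0 1 \<inter> {x. \<bar>x \<bullet> v\<bar> < c}"
  define w where "w k = (- (2 * c * real k)) *\<^sub>R v" for k :: nat
  let ?T = "\<lambda>k. (\<lambda>x. w k + x) -` ?A"
  have vv: "v \<bullet> v = 1" using v by (simp add: dot_square_norm)
  have oA: "open ?A" by (intro open_Int open_ball open_Collect_less continuous_intros)
  then have A[measurable]: "?A \<in> sets borel" by simp
  have oT: "open (?T k)" for k
    using oA by (intro continuous_open_vimage) (auto intro!: continuous_intros)
  then have T: "?T k \<in> sets lborel" for k by simp
  have eT: "emeasure lborel (?T k) = emeasure lborel ?A" for k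
  proof -
    have "emeasure lborel (?T k) = emeasure (distr lborel borel ((+) (w k))) ?A"
      using A by (subst emeasure_distr) auto
    then show ?thesis unfolding lborel_distr_plus .
  qed
  have mT: "measure lborel (?T k) = measure lborel ?A" for k
    using eT by (simp add: measure_def)
  have disj: "disjoint_family_on ?T {..<n}"
    unfolding disjoint_family_on_def
  proof (intro ballI impI)
    fix i j :: nat assume "i \<noteq> j"
    show "?T i \<inter> ?T j = {}"
    proof (rule ccontr)
      assume "?T i \<inter> ?T j \<noteq> {}"
      then obtain x where "\<bar>x \<bullet> v - 2 * c * real i\<bar> < c" "\<bar>x \<bullet> v - 2 * c * real j\<bar> < c"
        by (auto simp: inner_left_distrib vv w_def algebra_simps)
      then have "\<bar>2 * c * (real i - real j)\<bar> < 2 * c" by (simp add: algebra_simps)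
      then have "\<bar>real i - real j\<bar> < 1" using c by (simp add: abs_mult)
      with \<open>i \<noteq> j\<close> show False by linarith
    qed
  qed
  have sub: "(\<Union>k<n. ?T k) \<subseteq> ball 0 2"
  proof
    fix x assume "x \<in> (\<Union>k<n. ?T k)"
    then obtain k where k: "k < n" "norm (w k + x) < 1" by auto
    have "2 * c * real k \<le> 2 * c * real n" using k c by (intro mult_left_mono) auto
    from this n have "2 * c * real k \<le> 1" by (rule order_trans)
    then have "norm (w k) \<le> 1" using v c by (simp add: w_def)
    moreover have "norm x \<le> norm (w k + x) + norm (w k)"
      using norm_triangle_ineq4[of "w k + x" "w k"] by simp
    ultimately show "x \<in> ball 0 2" using k by simp
  qed
  have fin: "emeasure lborel (ball (0::'a) r) < \<infinity>" for r
    by (rule emeasure_lborel_ball_finite)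
  have "emeasure lborel ?A \<le> emeasure lborel (ball (0::'a) 1)" by (rule emeasure_mono) auto
  then have finA: "emeasure lborel ?A \<noteq> \<infinity>" using fin[of 1] by (auto simp: top_unique)
  have "real n * measure lborel ?A = (\<Sum>k<n. measure lborel (?T k))" by (simp only: mT sum_constant card_lessThan)
  also have "\<dots> = measure lborel (\<Union>k<n. ?T k)"
    using T eT finA disj by (intro measure_finite_Union[symmetric]) auto
  also have "\<dots> \<le> measure lborel (ball (0::'a) 2)"
    using sub T fin[of 2] by (intro measure_mono_fmeasurable) (auto simp: fmeasurable_def)
  also have "\<dots> = 2 ^ DIM('a) * measure lborel (ball (0::'a) 1)"
    using content_ball_conv_unit_ball[of 2 "0::'a"] by simp
  finally show ?thesis .
qed

text \<open>What matters is that \<open>c\<close> does not depend on \<open>u\<close>; it will be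
  used for \<open>u = y - x\<close> with \<open>y\<close> ranging over the whole space.\<close>

lemma sphere_unif_slab:
  assumes "0 < \<eta>"
  obtains c where "0 < c" "\<And>u :: 'a::euclidean_space. measure sphere_unif {\<theta>. \<bar>\<theta> \<bullet> u\<bar> < c * norm u} \<le> \<eta>"
proof -
  let ?B = "ball (0::'a) 1"
  \<comment> \<open>The slab has relative volume at most \<open>2 ^ d / n\<close>;
    \<open>c = 1 / (2 * n)\<close> is the largest half-width for which \<open>n\<close> disjoint
    translates stay within total shift 1.\<close>
  obtain n :: nat where n: "2 ^ DIM('a) / \<eta> < real n" using reals_Archimedean2 by blast
  then have n0: "0 < real n" using assms by (smt (verit) divide_nonneg_pos zero_le_power)
  define c where "c = 1 / (2 * real n)"
  have c: "0 < c" "2 * c * real n \<le> 1" using n0 by (auto simp: c_def)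
  have mB: "0 < measure lborel ?B" using content_ball_pos[of 1 "0::'a"] by simp
  show ?thesis
  proof (rule that[OF c(1)])
    fix u :: 'a
    show "measure sphere_unif {\<theta>. \<bar>\<theta> \<bullet> u\<bar> < c * norm u} \<le> \<eta>"
    proof (cases "u = 0")
      case True then show ?thesis using assms by simp
    next
      case False
      define v where "v = u /\<^sub>R norm u"
      have v: "norm v = 1" using False by (simp add: v_def)
      have eq: "{\<theta>. \<bar>\<theta> \<bullet> u\<bar> < c * norm u} = {\<theta>. \<bar>\<theta> \<bullet> v\<bar> < c}"
        using False by (auto simp: v_def field_simps abs_mult)
      have S: "{\<theta>. \<bar>\<theta> \<bullet> v\<bar> < c} \<in> sets borel"
        by (intro borel_open open_Collect_less continuous_intros)
      let ?S = "(\<lambda>x. x /\<^sub>R norm x) -` {\<theta>. \<bar>\<theta> \<bullet> v\<bar> < c}"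
      let ?A = "ball 0 1 \<inter> {x. \<bar>x \<bullet> v\<bar> < c}"
      have A: "?A \<in> sets borel" by (intro borel_open open_Int open_ball open_Collect_less continuous_intros)
      have S': "?S \<in> sets borel"
        using measurable_sets[OF _ S, of "\<lambda>x. x /\<^sub>R norm x" borel] by simp
      \<comment> \<open>Normalising a point of the unit ball can only increase
        \<open>\<bar>x \<bullet> v\<bar>\<close>, so the cone over the spherical slab lies, inside
        the ball, in the flat slab.\<close>
      have sub: "?B \<inter> ?S \<subseteq> ?A"
      proof
        fix x assume x: "x \<in> ?B \<inter> ?S"
        have "\<bar>x \<bullet> v\<bar> = norm x * \<bar>(x /\<^sub>R norm x) \<bullet> v\<bar>" by (cases "x = 0") (auto simp: abs_mult)
        also have "\<dots> \<le> 1 * \<bar>(x /\<^sub>R norm x) \<bullet> v\<bar>" using x by (intro mult_right_mono) auto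
        finally show "x \<in> ?A" using x by auto
      qed
      have "measure sphere_unif {\<theta>. \<bar>\<theta> \<bullet> v\<bar> < c} = measure (uniform_measure lborel ?B) ?S"
        unfolding sphere_unif_def using S by (subst measure_distr) auto
      also have "\<dots> = measure lborel (?B \<inter> ?S) / measure lborel ?B"
        using S' mB emeasure_lborel_ball_finite[of "0::'a" 1]
        by (intro measure_uniform_measure) (auto simp: emeasure_eq_ennreal_measure)
      also have "\<dots> \<le> measure lborel ?A / measure lborel ?B"
        using sub A S' mB emeasure_lborel_ball_finite[of "0::'a" 1]
        by (intro divide_right_mono measure_mono_fmeasurable)
           (auto simp: fmeasurable_def intro: le_less_trans[OF emeasure_mono])
      also have "\<dots> \<le> 2 ^ DIM('a) / real n"
        using measure_slab_le[OF v c] mB n0 by (simp add: field_simps)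
      also have "\<dots> \<le> \<eta>" using n n0 assms by (simp add: field_simps)
      finally show ?thesis by (simp add: eq)
    qed
  qed
qed

section \<open>Metric slopes\<close>

lemma eventually_at_metric:
  "eventually P (at_metric S m u) \<longleftrightarrow> (\<exists>e>0. \<forall>v\<in>S. v \<noteq> u \<longrightarrow> m u v < e \<longrightarrow> P v)"
proof -
  have "eventually P (INF e\<in>{0<..}. principal {v \<in> S. v \<noteq> u \<and> m u v < e})
      \<longleftrightarrow> (\<exists>e\<in>{0::real<..}. eventually P (principal {v \<in> S. v \<noteq> u \<and> m u v < e}))"
  proof (rule eventually_INF_base)
    fix a b :: real assume "a \<in> {0<..}" "b \<in> {0<..}"
    then show "\<exists>x\<in>{0<..}. principal {v \<in> S. v \<noteq> u \<and> m u v < x}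
        \<le> principal {v \<in> S. v \<noteq> u \<and> m u v < a} \<sqinter> principal {v \<in> S. v \<noteq> u \<and> m u v < b}"
      by (intro bexI[of _ "min a b"]) auto
  qed auto
  then show ?thesis unfolding at_metric_def by (auto simp: eventually_principal)
qed

text \<open>Points at distance 0 have quotient 0 by the convention for division, which is why the
  bound is required only for \<open>0 < m u v\<close>.\<close>

lemma metric_slope_le:
  assumes c: "0 \<le> c" and m: "\<And>v. 0 \<le> m u v"
    and le: "\<And>\<epsilon>. 0 < \<epsilon> \<Longrightarrow> \<exists>e>0. \<forall>v\<in>S. 0 < m u v \<longrightarrow> m u v < e \<longrightarrow> E u - E v \<le> (c + \<epsilon>) * m u v"
  shows "metric_slope S m E u \<le> ennreal c"
proof (rule ennreal_le_epsilon)
  fix \<epsilon> :: real assume \<epsilon>: "0 < \<epsilon>"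
  obtain e where e: "0 < e" "\<And>v. v \<in> S \<Longrightarrow> 0 < m u v \<Longrightarrow> m u v < e \<Longrightarrow> E u - E v \<le> (c + \<epsilon>) * m u v"
    using le[OF \<epsilon>] by blast
  have "max 0 (E u - E v) / m u v \<le> c + \<epsilon>" if "v \<in> S" "m u v < e" for v
  proof (cases "m u v = 0")
    case False
    with m[of v] have pos: "0 < m u v" by simp
    moreover from this have "0 \<le> (c + \<epsilon>) * m u v" using c \<epsilon> by simp
    ultimately show ?thesis using e(2)[OF that(1) pos that(2)] by (simp add: pos_divide_le_eq)
  qed (use c \<epsilon> in simp)
  then have "metric_slope S m E u \<le> ennreal (c + \<epsilon>)"
    unfolding metric_slope_def using e(1)
    by (intro Limsup_bounded) (auto simp: eventually_at_metric intro!: exI[of _ e] ennreal_leI)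
  then show "metric_slope S m E u \<le> ennreal c + ennreal \<epsilon>"
    using c \<epsilon> by (simp add: ennreal_plus)
qed

text \<open>By the same convention a competitor counts only if its distance to \<open>u\<close> is
  positive, so this has to be supplied together with the energy drop.\<close>

lemma metric_slope_ge:
  assumes m: "\<And>v. 0 \<le> m u v"
    and ge: "\<And>\<epsilon> e. 0 < \<epsilon> \<Longrightarrow> \<epsilon> < c \<Longrightarrow> 0 < e \<Longrightarrow>
      \<exists>v\<in>S. 0 < m u v \<and> m u v < e \<and> (c - \<epsilon>) * m u v \<le> E u - E v"
  shows "ennreal c \<le> metric_slope S m E u"
proof (cases "0 < c")
  case False then show ?thesis by (simp add: ennreal_neg)
next
  case True
  show ?thesis
    unfolding metric_slope_def Limsup_def
  proof (rule INF_greatest, rule ennreal_le_epsilon)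
    fix P and \<epsilon>' :: real
    assume "P \<in> {P. eventually P (at_metric S m u)}" and \<epsilon>': "0 < \<epsilon>'"
    then obtain e where e: "0 < e" "\<And>v. v \<in> S \<Longrightarrow> v \<noteq> u \<Longrightarrow> m u v < e \<Longrightarrow> P v"
      by (auto simp: eventually_at_metric)
    \<comment> \<open>The cap \<open>c / 2\<close> keeps \<open>c - \<epsilon>\<close> positive. The
      energy drop is then strictly positive, which forces \<open>v \<noteq> u\<close>.\<close>
    define \<epsilon> where "\<epsilon> = min \<epsilon>' (c / 2)"
    have \<epsilon>: "0 < \<epsilon>" "\<epsilon> < c" "\<epsilon> \<le> \<epsilon>'" using \<epsilon>' True by (auto simp: \<epsilon>_def)
    obtain v where v: "v \<in> S" "0 < m u v" "m u v < e" "(c - \<epsilon>) * m u v \<le> E u - E v"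
      using ge[OF \<epsilon>(1,2) e(1)] by blast
    have pos: "0 < (c - \<epsilon>) * m u v" using \<epsilon> v by simp
    then have "v \<noteq> u" using v by auto
    then have "P v" using e v by blast
    have "c - \<epsilon> \<le> max 0 (E u - E v) / m u v" using v pos by (simp add: pos_le_divide_eq)
    then have "ennreal c \<le> ennreal (max 0 (E u - E v) / m u v + \<epsilon>')"
      using \<epsilon> by (intro ennreal_leI) linarith
    also have "\<dots> = ennreal (max 0 (E u - E v) / m u v) + ennreal \<epsilon>'"
      using m \<epsilon>' by (intro ennreal_plus) auto
    also have "\<dots> \<le> (SUP v\<in>{v. P v}. ennreal (max 0 (E u - E v) / m u v)) + ennreal \<epsilon>'"
      using \<open>P v\<close> by (intro add_right_mono SUP_upper) auto
    finally show "ennreal c \<le> (SUP v\<in>{v. P v}. ennreal (max 0 (E u - E v) / m u v)) + ennreal \<epsilon>'" .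
  qed
qed

section \<open>Young's inequality and the choice of its weight\<close>

text \<open>\<open>l = A / w\<close> minimises the right-hand side. This converts quadratic duality
  bounds into a bound linear in \<open>w\<close>; positivity of \<open>A\<close> is what makes this
  weight admissible.\<close>

lemma le_of_young:
  fixes A w K \<Delta> :: real
  assumes "0 < A" "0 < w" and young: "\<And>l. 0 < l \<Longrightarrow> \<Delta> \<le> A\<^sup>2 / (2 * l) + (l / 2 + K) * w\<^sup>2"
  shows "\<Delta> \<le> A * w + K * w\<^sup>2"
proof -
  have "A\<^sup>2 / (2 * (A / w)) + (A / w / 2 + K) * w\<^sup>2 = A * w + K * w\<^sup>2"
    using assms(1,2) by (simp add: divide_simps power2_eq_square algebra_simps)
  then show ?thesis using young[of "A / w"] assms(1,2) by simp
qed

lemma young_mult: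
  fixes a b l :: real
  assumes "0 < l"
  shows "a * b \<le> a\<^sup>2 / (2 * l) + l / 2 * b\<^sup>2"
proof -
  have "0 \<le> (a - l * b)\<^sup>2" by simp
  then have "2 * l * (a * b) \<le> a\<^sup>2 + l\<^sup>2 * b\<^sup>2" by (simp add: power2_eq_square algebra_simps)
  then show ?thesis using assms by (simp add: field_simps power2_eq_square)
qed

section \<open>The sliced Wasserstein distance\<close>

lemma coupling_proj:
  fixes \<mu> \<nu> :: "'a::euclidean_space measure"
  assumes \<pi>: "\<pi> \<in> couplings \<mu> \<nu>"
  shows "distr \<pi> borel (\<lambda>z. (fst z \<bullet> \<theta>, snd z \<bullet> \<theta>)) \<in> couplings (proj \<theta> \<mu>) (proj \<theta> \<nu>)"
proof -
  note [measurable] = couplings_measurable[OF \<pi>]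
  have [measurable]: "fst \<in> measurable borel (borel :: real measure)" "snd \<in> measurable borel (borel :: real measure)"
    by (simp_all add: borel_measurable_continuous_onI continuous_on_fst continuous_on_snd)
  have [measurable]: "(\<lambda>z. (fst z \<bullet> \<theta>, snd z \<bullet> \<theta>)) \<in> borel_measurable \<pi>"
    by (simp add: borel_prod[symmetric])
  have "proj \<theta> (distr \<pi> borel fst) = distr \<pi> borel (\<lambda>z. fst z \<bullet> \<theta>)"
    "proj \<theta> (distr \<pi> borel snd) = distr \<pi> borel (\<lambda>z. snd z \<bullet> \<theta>)"
    by (auto simp: proj_def distr_distr comp_def)
  then show ?thesis
    unfolding couplings_def using couplingsD[OF \<pi>] by (auto simp: distr_distr comp_def)
qed

lemma W_proj_le:
  fixes \<mu> \<nu> :: "'a::euclidean_space measure"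
  assumes "\<mu> \<in> P2" "\<nu> \<in> P2" "\<pi> \<in> couplings \<mu> \<nu>"
  shows "(W (proj \<theta> \<mu>) (proj \<theta> \<nu>))\<^sup>2 \<le> (\<integral>z. ((fst z - snd z) \<bullet> \<theta>)\<^sup>2 \<partial>\<pi>)"
proof -
  note [measurable] = couplings_measurable[OF assms(3)]
  have [measurable]: "fst \<in> measurable borel (borel :: real measure)" "snd \<in> measurable borel (borel :: real measure)"
    by (simp_all add: borel_measurable_continuous_onI continuous_on_fst continuous_on_snd)
  have [measurable]: "(\<lambda>z. (fst z \<bullet> \<theta>, snd z \<bullet> \<theta>)) \<in> borel_measurable \<pi>"
    by (simp add: borel_prod[symmetric])
  show ?thesis
    using W_le_coupling[OF proj_P2 proj_P2 coupling_proj, OF assms, of \<theta>]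
    by (simp add: integral_distr dist_norm inner_diff_left power2_eq_square abs_mult[symmetric])
qed

text \<open>A coupling projects to a coupling on every line. By Tonelli and isotropy the mean over
  \<open>\<theta>\<close> of the projected squared displacement is the full squared displacement
  divided by the dimension.\<close>

lemma nn_integral_W_proj_le:
  fixes \<mu> \<nu> :: "'a::euclidean_space measure"
  assumes \<mu>: "\<mu> \<in> P2" and \<nu>: "\<nu> \<in> P2" and \<pi>: "\<pi> \<in> couplings \<mu> \<nu>"
  shows "(\<integral>\<^sup>+\<theta>. ennreal ((W (proj \<theta> \<mu>) (proj \<theta> \<nu>))\<^sup>2) \<partial>sphere_unif)
    \<le> ennreal ((\<integral>z. (dist (fst z) (snd z))\<^sup>2 \<partial>\<pi>) / DIM('a))"
proof -
  interpret S: prob_space "sphere_unif :: 'a measure" by (rule sphere_unif_prob_space)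
  interpret \<pi>: prob_space \<pi> using couplings_prob_space[OF \<pi>] P2D[OF \<mu>] by simp
  interpret P: pair_sigma_finite "sphere_unif :: 'a measure" \<pi> ..
  note [measurable] = couplings_measurable[OF \<pi>]
  note id = coupling_dist_integrable[OF \<pi> \<mu> \<nu>]
  have CS: "(w \<bullet> \<theta>)\<^sup>2 \<le> (norm w)\<^sup>2 * (norm \<theta>)\<^sup>2" for w \<theta> :: 'a
    using Cauchy_Schwarz_ineq[of w \<theta>] by (simp add: power2_norm_eq_inner)
  have i: "integrable \<pi> (\<lambda>z. ((fst z - snd z) \<bullet> \<theta>)\<^sup>2)" for \<theta>
  proof (rule Bochner_Integration.integrable_bound)
    show "integrable \<pi> (\<lambda>z. (dist (fst z) (snd z))\<^sup>2 * (norm \<theta>)\<^sup>2)" using id by simp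
    show "AE z in \<pi>. norm (((fst z - snd z) \<bullet> \<theta>)\<^sup>2) \<le> norm ((dist (fst z) (snd z))\<^sup>2 * (norm \<theta>)\<^sup>2)"
      using CS by (auto simp: dist_norm)
  qed measurable
  have "(\<integral>\<^sup>+\<theta>. ennreal ((W (proj \<theta> \<mu>) (proj \<theta> \<nu>))\<^sup>2) \<partial>sphere_unif)
      \<le> (\<integral>\<^sup>+\<theta>. ennreal (\<integral>z. ((fst z - snd z) \<bullet> \<theta>)\<^sup>2 \<partial>\<pi>) \<partial>sphere_unif)"
    by (intro nn_integral_mono ennreal_leI W_proj_le[OF assms])
  also have "\<dots> = (\<integral>\<^sup>+\<theta>. (\<integral>\<^sup>+z. ennreal (((fst z - snd z) \<bullet> \<theta>)\<^sup>2) \<partial>\<pi>) \<partial>sphere_unif)"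
    using i by (simp add: nn_integral_eq_integral)
  also have "\<dots> = (\<integral>\<^sup>+z. (\<integral>\<^sup>+\<theta>. ennreal (((fst z - snd z) \<bullet> \<theta>)\<^sup>2) \<partial>sphere_unif) \<partial>\<pi>)"
    by (rule P.Fubini'[symmetric]) measurable
  also have "\<dots> = (\<integral>\<^sup>+z. ennreal ((dist (fst z) (snd z))\<^sup>2 / DIM('a)) \<partial>\<pi>)"
  proof (intro nn_integral_cong)
    fix z :: "'a \<times> 'a"
    let ?w = "fst z - snd z"
    have "(\<integral>\<^sup>+\<theta>. ennreal ((?w \<bullet> \<theta>)\<^sup>2) \<partial>sphere_unif) = ennreal (\<integral>\<theta>. (\<theta> \<bullet> ?w) * (\<theta> \<bullet> ?w) \<partial>sphere_unif)"
      using nn_integral_eq_integral[OF integrable_sphere_unif_inner[of ?w ?w]]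
      by (simp add: power2_eq_square inner_commute)
    then show "(\<integral>\<^sup>+\<theta>. ennreal ((?w \<bullet> \<theta>)\<^sup>2) \<partial>sphere_unif) = ennreal ((dist (fst z) (snd z))\<^sup>2 / DIM('a))"
      by (simp add: sphere_unif_inner_inner dist_norm power2_norm_eq_inner)
  qed
  also have "\<dots> = ennreal ((\<integral>z. (dist (fst z) (snd z))\<^sup>2 \<partial>\<pi>) / DIM('a))"
    using id by (subst nn_integral_eq_integral) auto
  finally show ?thesis .
qed

lemma ennreal_SW_squared:
  fixes \<mu> \<nu> :: "'a::euclidean_space measure"
  assumes "\<mu> \<in> P2" "\<nu> \<in> P2"
  shows "ennreal ((SW \<mu> \<nu>)\<^sup>2) = (\<integral>\<^sup>+\<theta>. ennreal ((W (proj \<theta> \<mu>) (proj \<theta> \<nu>))\<^sup>2) \<partial>sphere_unif)"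
proof -
  have "(\<integral>\<^sup>+\<theta>. ennreal ((W (proj \<theta> \<mu>) (proj \<theta> \<nu>))\<^sup>2) \<partial>sphere_unif) < \<infinity>"
    by (rule le_less_trans[OF nn_integral_W_proj_le[OF assms couplings_nonempty[OF assms]]]) simp
  then show ?thesis by (simp add: SW_def)
qed

lemma SW_squared_le_W_squared:
  fixes \<mu> \<nu> :: "'a::euclidean_space measure"
  assumes "\<mu> \<in> P2" "\<nu> \<in> P2"
  shows "DIM('a) * (SW \<mu> \<nu>)\<^sup>2 \<le> (W \<mu> \<nu>)\<^sup>2"
proof (rule le_W_squared[OF assms])
  fix \<pi> assume "\<pi> \<in> couplings \<mu> \<nu>"
  from nn_integral_W_proj_le[OF assms this]
  show "DIM('a) * (SW \<mu> \<nu>)\<^sup>2 \<le> (\<integral>z. (dist (fst z) (snd z))\<^sup>2 \<partial>\<pi>)"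
    unfolding ennreal_SW_squared[OF assms, symmetric]
    by (simp add: ennreal_le_iff field_simps)
qed

lemma SW_le_W:
  fixes \<mu> \<nu> :: "'a::euclidean_space measure"
  assumes "\<mu> \<in> P2" "\<nu> \<in> P2"
  shows "sqrt DIM('a) * SW \<mu> \<nu> \<le> W \<mu> \<nu>"
  using SW_squared_le_W_squared[OF assms]
  by (auto intro!: power2_le_imp_le[of "sqrt DIM('a) * SW \<mu> \<nu>"] simp: power_mult_distrib)

text \<open>Only a measurable lower bound of the integrand is used, so measurability of
  \<open>\<theta> \<mapsto> W (proj \<theta> \<mu>) (proj \<theta> \<nu>)\<close> is never needed.\<close>

lemma integral_le_SW:
  fixes \<mu> \<nu> :: "'a::euclidean_space measure"
  assumes "\<mu> \<in> P2" "\<nu> \<in> P2" and h: "integrable sphere_unif h" and "0 < K"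
    and le: "AE \<theta> in sphere_unif. h \<theta> \<le> K * (W (proj \<theta> \<mu>) (proj \<theta> \<nu>))\<^sup>2"
  shows "(\<integral>\<theta>. h \<theta> \<partial>sphere_unif) \<le> K * (SW \<mu> \<nu>)\<^sup>2"
proof -
  have "ennreal (\<integral>\<theta>. h \<theta> / K \<partial>sphere_unif) \<le> (\<integral>\<^sup>+\<theta>. ennreal (h \<theta> / K) \<partial>sphere_unif)"
  proof -
    have i: "integrable sphere_unif (\<lambda>\<theta>. max 0 (h \<theta> / K))" using h by auto
    have "ennreal (\<integral>\<theta>. h \<theta> / K \<partial>sphere_unif) \<le> ennreal (\<integral>\<theta>. max 0 (h \<theta> / K) \<partial>sphere_unif)"
      using h i by (intro ennreal_leI integral_mono) auto
    also have "\<dots> = (\<integral>\<^sup>+\<theta>. ennreal (max 0 (h \<theta> / K)) \<partial>sphere_unif)"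
      using i by (intro nn_integral_eq_integral[symmetric]) auto
    also have "\<dots> = (\<integral>\<^sup>+\<theta>. ennreal (h \<theta> / K) \<partial>sphere_unif)"
      by (intro nn_integral_cong) (simp add: max_def ennreal_neg)
    finally show ?thesis .
  qed
  also have "\<dots> \<le> (\<integral>\<^sup>+\<theta>. ennreal ((W (proj \<theta> \<mu>) (proj \<theta> \<nu>))\<^sup>2) \<partial>sphere_unif)"
    using le \<open>0 < K\<close> by (intro nn_integral_mono_AE) (auto elim!: eventually_mono intro!: ennreal_leI simp: field_simps)
  also have "\<dots> = ennreal ((SW \<mu> \<nu>)\<^sup>2)" using ennreal_SW_squared[OF assms(1,2)] by simp
  finally have "(\<integral>\<theta>. h \<theta> / K \<partial>sphere_unif) \<le> (SW \<mu> \<nu>)\<^sup>2" by (simp add: ennreal_le_iff)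
  then show ?thesis using \<open>0 < K\<close> by (simp add: field_simps)
qed

section \<open>Fubini over directions and points\<close>

lemma integrable_sphere_unif_norm: "integrable sphere_unif (\<lambda>\<theta>::'a::euclidean_space. (norm \<theta>)\<^sup>2)"
  using sphere_unif_prob_space AE_sphere_unif_norm
  by (intro finite_measure.integrable_const_bound[where B = 1] prob_space.finite_measure)
    (auto elim!: eventually_mono)

lemma pair_prob_space_sphere_unif:
  assumes "prob_space \<nu>"
  shows "pair_prob_space (sphere_unif :: 'a::euclidean_space measure) \<nu>"
  using assms sphere_unif_prob_space[where 'a = 'a]
  by (simp add: pair_prob_space_def pair_sigma_finite_def prob_space_imp_sigma_finite)

text \<open>The weight \<open>(norm \<theta>)\<^sup>2\<close> equals 1 almost surely. With it,
  Cauchy-Schwarz provides a majorant at every \<open>\<theta>\<close> of the ambient space that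
  carries \<open>sphere_unif\<close>, so the inner integrals exist for each \<open>\<theta>\<close>
  and not merely for almost all.\<close>

lemma
  fixes f :: "'a::euclidean_space \<Rightarrow> 'a \<Rightarrow> real"
  assumes \<nu>: "prob_space \<nu>" and s: "sets \<nu> = sets borel"
    and f: "case_prod f \<in> borel_measurable (borel \<Otimes>\<^sub>M borel)"
    and w: "integrable \<nu> w" and le: "\<And>\<theta> y. \<bar>f \<theta> y\<bar> \<le> w y * (norm \<theta>)\<^sup>2"
  shows sphere_unif_Fubini: "(\<integral>\<theta>. (\<integral>y. f \<theta> y \<partial>\<nu>) \<partial>sphere_unif) = (\<integral>y. (\<integral>\<theta>. f \<theta> y \<partial>sphere_unif) \<partial>\<nu>)"
    and sphere_unif_integrable_inner: "integrable \<nu> (f \<theta>)"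
    and sphere_unif_integrable_fst: "integrable sphere_unif (\<lambda>\<theta>. \<integral>y. f \<theta> y \<partial>\<nu>)"
    and sphere_unif_integrable_snd: "integrable \<nu> (\<lambda>y. \<integral>\<theta>. f \<theta> y \<partial>sphere_unif)"
proof -
  interpret P: pair_prob_space "sphere_unif :: 'a measure" \<nu>
    using \<nu> by (rule pair_prob_space_sphere_unif)
  note [measurable_cong] = s
  note [measurable] = f borel_measurable_integrable[OF w]
  have iw: "integrable (sphere_unif \<Otimes>\<^sub>M \<nu>) (\<lambda>(\<theta>::'a, y). w y * (norm \<theta>)\<^sup>2)"
    using w integrable_sphere_unif_norm by (intro P.Fubini_integrable) (auto simp: abs_mult)
  have i: "integrable (sphere_unif \<Otimes>\<^sub>M \<nu>) (case_prod f)"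
    using iw by (rule Bochner_Integration.integrable_bound)
      (use le in \<open>auto intro!: AE_I2 order_trans[OF _ abs_ge_self]\<close>)
  show "(\<integral>\<theta>. (\<integral>y. f \<theta> y \<partial>\<nu>) \<partial>sphere_unif) = (\<integral>y. (\<integral>\<theta>. f \<theta> y \<partial>sphere_unif) \<partial>\<nu>)"
    using i by (rule P.Fubini_integral[symmetric])
  have "integrable \<nu> (\<lambda>y. w y * (norm \<theta>)\<^sup>2)" using w by simp
  then show "integrable \<nu> (f \<theta>)"
    by (rule Bochner_Integration.integrable_bound)
      (use le in \<open>auto intro!: AE_I2 order_trans[OF _ abs_ge_self]\<close>)
  show "integrable sphere_unif (\<lambda>\<theta>. \<integral>y. f \<theta> y \<partial>\<nu>)"
    using P.integrable_fst'[OF i] by simp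
  show "integrable \<nu> (\<lambda>y. \<integral>\<theta>. f \<theta> y \<partial>sphere_unif)"
    using P.integrable_snd[OF i] by simp
qed

section \<open>Second moments through projections\<close>

lemma inner_squared_le:
  fixes w \<theta> :: "'a::real_inner"
  shows "\<bar>(w \<bullet> \<theta>)\<^sup>2\<bar> \<le> (norm w)\<^sup>2 * (norm \<theta>)\<^sup>2"
  using Cauchy_Schwarz_ineq[of w \<theta>] by (simp add: power2_norm_eq_inner)

lemma integral_inner_squared:
  fixes w :: "'a::euclidean_space"
  shows "(\<integral>\<theta>. (w \<bullet> \<theta>)\<^sup>2 \<partial>sphere_unif) = (norm w)\<^sup>2 / DIM('a)"
  using sphere_unif_inner_inner[of w w] by (simp add: power2_eq_square inner_commute dot_square_norm)

lemma
  fixes \<mu> :: "'a::euclidean_space measure"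
  assumes \<mu>: "\<mu> \<in> P2"
  shows sliced_second_moment_integrable: "integrable sphere_unif (\<lambda>\<theta>. \<integral>x. (x \<bullet> \<theta>)\<^sup>2 \<partial>\<mu>)"
    and sliced_second_moment: "(\<integral>\<theta>. (\<integral>x. (x \<bullet> \<theta>)\<^sup>2 \<partial>\<mu>) \<partial>sphere_unif) = (\<integral>x. (norm x)\<^sup>2 \<partial>\<mu>) / DIM('a)"
    and integrable_inner_squared: "integrable \<mu> (\<lambda>x. (x \<bullet> \<theta>)\<^sup>2)"
proof -
  note f = P2D(1,2)[OF \<mu>] _ P2D(4)[OF \<mu>] inner_squared_le
  show "integrable sphere_unif (\<lambda>\<theta>. \<integral>x. (x \<bullet> \<theta>)\<^sup>2 \<partial>\<mu>)"
    by (rule sphere_unif_integrable_fst[OF f]) measurable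
  show "integrable \<mu> (\<lambda>x. (x \<bullet> \<theta>)\<^sup>2)"
    by (rule sphere_unif_integrable_inner[OF f]) measurable
  have "(\<integral>\<theta>. (\<integral>x. (x \<bullet> \<theta>)\<^sup>2 \<partial>\<mu>) \<partial>sphere_unif) = (\<integral>x. (\<integral>\<theta>. (x \<bullet> \<theta>)\<^sup>2 \<partial>sphere_unif) \<partial>\<mu>)"
    by (rule sphere_unif_Fubini[OF f]) measurable
  then show "(\<integral>\<theta>. (\<integral>x. (x \<bullet> \<theta>)\<^sup>2 \<partial>\<mu>) \<partial>sphere_unif) = (\<integral>x. (norm x)\<^sup>2 \<partial>\<mu>) / DIM('a)"
    by (simp add: integral_inner_squared)
qed

lemma integral_proj:
  fixes \<mu> :: "'a::euclidean_space measure" and h :: "real \<Rightarrow> real"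
  assumes "sets \<mu> = sets borel" "h \<in> borel_measurable borel"
  shows "integral\<^sup>L (proj \<theta> \<mu>) h = (\<integral>x. h (x \<bullet> \<theta>) \<partial>\<mu>)"
    and "integrable (proj \<theta> \<mu>) h \<longleftrightarrow> integrable \<mu> (\<lambda>x. h (x \<bullet> \<theta>))"
proof -
  note [measurable_cong] = assms(1)
  note [measurable] = assms(2)
  show "integral\<^sup>L (proj \<theta> \<mu>) h = (\<integral>x. h (x \<bullet> \<theta>) \<partial>\<mu>)"
    unfolding proj_def by (simp add: integral_distr)
  show "integrable (proj \<theta> \<mu>) h \<longleftrightarrow> integrable \<mu> (\<lambda>x. h (x \<bullet> \<theta>))"
    unfolding proj_def by (simp add: integrable_distr_eq)
qed

lemma square_le_split:
  fixes a b l :: real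
  assumes "0 < l"
  shows "b\<^sup>2 \<le> (1 + l) * a\<^sup>2 + (1 + 1 / l) * (a - b)\<^sup>2"
proof -
  have "(1 + l) * a\<^sup>2 + (1 + 1 / l) * (a - b)\<^sup>2 - b\<^sup>2 = (l * a + (a - b))\<^sup>2 / l"
    using assms by (simp add: field_simps power2_eq_square)
  also have "\<dots> \<ge> 0" using assms by simp
  finally show ?thesis by simp
qed

text \<open>The one fact about non-degeneracy of \<open>SW\<close> used below: it certifies that a
  competitor with a different second moment lies at positive distance. The potentials
  \<open>x\<^sup>2\<close> and \<open>- (1 + l) * y\<^sup>2\<close> are admissible for the cost
  \<open>(1 + 1 / l) * (x - y)\<^sup>2\<close>, and they average over \<open>\<theta>\<close> to
  second moments. The large constant multiplies \<open>SW \<mu> \<nu> = 0\<close>, so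
  \<open>l\<close> may tend to 0.\<close>

lemma SW_eq_0_second_moment:
  fixes \<mu> \<nu> :: "'a::euclidean_space measure"
  assumes \<mu>: "\<mu> \<in> P2" and \<nu>: "\<nu> \<in> P2" and 0: "SW \<mu> \<nu> = 0"
  shows "(\<integral>x. (norm x)\<^sup>2 \<partial>\<mu>) = (\<integral>x. (norm x)\<^sup>2 \<partial>\<nu>)"
proof -
  let ?M = "\<lambda>\<mu>::'a measure. \<integral>x. (norm x)\<^sup>2 \<partial>\<mu>"
  let ?m = "\<lambda>(\<mu>::'a measure) \<theta>. \<integral>x. (x \<bullet> \<theta>)\<^sup>2 \<partial>\<mu>"
  have dual: "a * ?M \<mu> + b * ?M \<nu> \<le> 0"
    if K: "0 < K" and ab: "\<And>x y::real. a * x\<^sup>2 + b * y\<^sup>2 \<le> K * (x - y)\<^sup>2" for a b K :: real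
  proof -
    have "a * ?m \<mu> \<theta> + b * ?m \<nu> \<theta> \<le> K * (W (proj \<theta> \<mu>) (proj \<theta> \<nu>))\<^sup>2" for \<theta>
    proof -
      have "integral\<^sup>L (proj \<theta> \<mu>) (\<lambda>x. a * x\<^sup>2) + integral\<^sup>L (proj \<theta> \<nu>) (\<lambda>x. b * x\<^sup>2)
          \<le> K * (W (proj \<theta> \<mu>) (proj \<theta> \<nu>))\<^sup>2"
        using ab K integrable_inner_squared[OF \<mu>] integrable_inner_squared[OF \<nu>]
        by (intro W_dual proj_P2 \<mu> \<nu> integrable_mult_right)
          (auto simp: integral_proj(2) P2D(2)[OF \<mu>] P2D(2)[OF \<nu>] dist_real_def)
      then show ?thesis using P2D(2)[OF \<mu>] P2D(2)[OF \<nu>] by (simp add: integral_proj(1))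
    qed
    then have "(\<integral>\<theta>. a * ?m \<mu> \<theta> + b * ?m \<nu> \<theta> \<partial>sphere_unif) \<le> K * (SW \<mu> \<nu>)\<^sup>2"
      using K sliced_second_moment_integrable[OF \<mu>] sliced_second_moment_integrable[OF \<nu>]
      by (intro integral_le_SW[OF \<mu> \<nu>] Bochner_Integration.integrable_add integrable_mult_right) auto
    moreover have "(\<integral>\<theta>. a * ?m \<mu> \<theta> + b * ?m \<nu> \<theta> \<partial>sphere_unif) = (a * ?M \<mu> + b * ?M \<nu>) / DIM('a)"
      using sliced_second_moment_integrable[OF \<mu>] sliced_second_moment_integrable[OF \<nu>]
      by (simp add: sliced_second_moment \<mu> \<nu> add_divide_distrib)
    ultimately show ?thesis using 0 by (simp add: field_simps)
  qed
  have le: "p \<le> q" if pos: "0 \<le> q" and l: "\<And>l. 0 < l \<Longrightarrow> p \<le> (1 + l) * q" for p q :: real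
  proof (rule field_le_epsilon)
    fix e :: real assume e: "0 < e"
    have "p \<le> (1 + e / (q + 1)) * q" using l[of "e / (q + 1)"] e pos by simp
    also have "\<dots> \<le> q + e" using e pos by (simp add: field_simps)
    finally show "p \<le> q + e" .
  qed
  have nn: "0 \<le> ?M \<mu>" "0 \<le> ?M \<nu>" by simp_all
  show ?thesis
  proof (rule antisym)
    show "?M \<mu> \<le> ?M \<nu>"
    proof (rule le[OF nn(2)])
      fix l :: real assume l: "0 < l"
      show "?M \<mu> \<le> (1 + l) * ?M \<nu>"
        using dual[of "1 + 1 / l" 1 "- (1 + l)"] l square_le_split[OF l]
        by (simp add: add_pos_pos power2_commute algebra_simps)
    qed
    show "?M \<nu> \<le> ?M \<mu>"
    proof (rule le[OF nn(1)])
      fix l :: real assume l: "0 < l"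
      show "?M \<nu> \<le> (1 + l) * ?M \<mu>"
        using dual[of "1 + 1 / l" "- (1 + l)" 1] l square_le_split[OF l]
        by (simp add: add_pos_pos algebra_simps)
    qed
  qed
qed

section \<open>Distance to a finite support\<close>

text \<open>A union bound in which each slab receives the share \<open>\<eta> / (n + 1)\<close>; the
  extra 1 avoids division by 0. Again \<open>c\<close> depends on the number of vectors and not on
  the vectors.\<close>

lemma sphere_unif_slabs:
  assumes "0 < \<eta>"
  obtains c where "0 < c"
    "\<And>U :: 'a::euclidean_space set. finite U \<Longrightarrow> card U \<le> n \<Longrightarrow>
      measure sphere_unif {\<theta>. \<exists>u\<in>U. \<bar>\<theta> \<bullet> u\<bar> < c * norm u} \<le> \<eta>"
proof -
  interpret prob_space "sphere_unif :: 'a measure" by (rule sphere_unif_prob_space)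
  obtain c where c: "0 < c"
    "\<And>u :: 'a. measure sphere_unif {\<theta>. \<bar>\<theta> \<bullet> u\<bar> < c * norm u} \<le> \<eta> / (real n + 1)"
    using sphere_unif_slab[of "\<eta> / (real n + 1)"] assms by auto
  show ?thesis
  proof (rule that[OF c(1)])
    fix U :: "'a set" assume U: "finite U" "card U \<le> n"
    let ?S = "\<lambda>u. {\<theta>. \<bar>\<theta> \<bullet> u\<bar> < c * norm u}"
    have "measure sphere_unif {\<theta>. \<exists>u\<in>U. \<bar>\<theta> \<bullet> u\<bar> < c * norm u} = measure sphere_unif (\<Union>u\<in>U. ?S u)"
      by (rule arg_cong[where f = "measure sphere_unif"]) auto
    also have "\<dots> \<le> (\<Sum>u\<in>U. measure sphere_unif (?S u))"
      using U by (intro finite_measure_subadditive_finite)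
        (auto intro!: borel_open open_Collect_less continuous_intros)
    also have "\<dots> \<le> (\<Sum>u\<in>U. \<eta> / (real n + 1))" by (intro sum_mono c(2))
    also have "\<dots> = real (card U) * (\<eta> / (real n + 1))" by simp
    also have "\<dots> \<le> real n * (\<eta> / (real n + 1))" using U assms by (intro mult_right_mono) auto
    also have "\<dots> \<le> \<eta>" using assms by (simp add: field_simps)
    finally show "measure sphere_unif {\<theta>. \<exists>u\<in>U. \<bar>\<theta> \<bullet> u\<bar> < c * norm u} \<le> \<eta>" .
  qed
qed

lemma borel_slabs:
  fixes U :: "'a::euclidean_space set"
  shows "{\<theta>. \<exists>u\<in>U. \<bar>\<theta> \<bullet> u\<bar> < c * norm u} \<in> sets borel"
proof -
  have "{\<theta>. \<exists>u\<in>U. \<bar>\<theta> \<bullet> u\<bar> < c * norm u} = (\<Union>u\<in>U. {\<theta>. \<bar>\<theta> \<bullet> u\<bar> < c * norm u})" by auto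
  also have "open \<dots>" by (intro open_UN ballI open_Collect_less continuous_intros)
  finally show ?thesis by (rule borel_open)
qed

lemma AE_proj_finite:
  fixes \<mu> :: "'a::euclidean_space measure"
  assumes "sets \<mu> = sets borel" "finite X" "AE x in \<mu>. x \<in> X"
  shows "AE z in proj \<theta> \<mu>. \<exists>x\<in>X. z = x \<bullet> \<theta>"
proof -
  note [measurable_cong] = assms(1)
  have "{z. z \<in> (\<lambda>x. x \<bullet> \<theta>) ` X} \<in> sets borel" using assms(2) by (simp add: finite_imp_closed)
  then have "AE z in proj \<theta> \<mu>. z \<in> (\<lambda>x. x \<bullet> \<theta>) ` X"
    unfolding proj_def using assms(3) by (subst AE_distr_iff) (auto elim!: eventually_mono)
  then show ?thesis by eventually_elim auto
qed

text \<open>For at least half of the directions all differences \<open>y - x\<close> with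
  \<open>x \<in> X\<close> keep a fixed fraction of their length under projection. Hence the squared
  distance to \<open>X\<close> is controlled by the mean squared distance of
  \<open>y \<bullet> \<theta>\<close> to the projected atoms. On each line the latter is at most the
  transport cost, since all mass of \<open>proj \<theta> \<mu>\<close> starts at projected
  atoms.\<close>

lemma infdist_second_moment_le_SW:
  fixes \<mu> :: "'a::euclidean_space measure"
  assumes \<mu>: "\<mu> \<in> P2" and X: "finite X" "X \<noteq> {}" "AE x in \<mu>. x \<in> X"
  obtains C where "0 < C" "\<And>\<nu>. \<nu> \<in> P2 \<Longrightarrow> integrable \<nu> (\<lambda>y. (infdist y X)\<^sup>2)"
    "\<And>\<nu>. \<nu> \<in> P2 \<Longrightarrow> (\<integral>y. (infdist y X)\<^sup>2 \<partial>\<nu>) \<le> C * (SW \<mu> \<nu>)\<^sup>2"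
proof -
  interpret S: prob_space "sphere_unif :: 'a measure" by (rule sphere_unif_prob_space)
  obtain c where c: "0 < c"
    "\<And>U :: 'a set. finite U \<Longrightarrow> card U \<le> card X \<Longrightarrow>
      measure sphere_unif {\<theta>. \<exists>u\<in>U. \<bar>\<theta> \<bullet> u\<bar> < c * norm u} \<le> 1 / 2"
    using sphere_unif_slabs[of "1 / 2" "card X"] by auto
  obtain x0 where x0: "x0 \<in> X" using X by blast
  \<comment> \<open>The squared distance on the line from the projection of \<open>y\<close> to the
    nearest projected atom.\<close>
  define f where "f \<theta> y = Min ((\<lambda>x. ((y - x) \<bullet> \<theta>)\<^sup>2) ` X)" for \<theta> y :: 'a
  have f_le: "f \<theta> y \<le> ((y - x) \<bullet> \<theta>)\<^sup>2" if "x \<in> X" for \<theta> y x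
    unfolding f_def using X that by (intro Min_le) auto
  have f_ge: "b \<le> f \<theta> y" if "\<And>x. x \<in> X \<Longrightarrow> b \<le> ((y - x) \<bullet> \<theta>)\<^sup>2" for b \<theta> y
    unfolding f_def using X that by simp
  have f_meas[measurable]: "case_prod f \<in> borel_measurable (borel \<Otimes>\<^sub>M borel)"
    unfolding f_def using X(1) by measurable
  have f_bound: "\<bar>f \<theta> y\<bar> \<le> (norm (y - x0))\<^sup>2 * (norm \<theta>)\<^sup>2" for \<theta> y
  proof -
    have "0 \<le> f \<theta> y" by (rule f_ge) simp
    then show ?thesis using f_le[OF x0, of \<theta> y] inner_squared_le[of "y - x0" \<theta>] by linarith
  qed
  have lower: "c\<^sup>2 / 2 * (infdist y X)\<^sup>2 \<le> (\<integral>\<theta>. f \<theta> y \<partial>sphere_unif)" for y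
  proof -
    \<comment> \<open>The bad directions depend on \<open>y\<close>, but the constant
      \<open>c\<close> was fixed before \<open>y\<close> from \<open>card X\<close> alone.\<close>
    define B where "B = {\<theta>. \<exists>u\<in>(\<lambda>x. y - x) ` X. \<bar>\<theta> \<bullet> u\<bar> < c * norm u}"
    have B[measurable]: "B \<in> sets borel" unfolding B_def by (rule borel_slabs)
    have "integrable sphere_unif (\<lambda>\<theta>. f \<theta> y)"
    proof (rule Bochner_Integration.integrable_bound)
      show "integrable sphere_unif (\<lambda>\<theta>::'a. (norm (y - x0))\<^sup>2 * (norm \<theta>)\<^sup>2)"
        by (intro integrable_mult_right integrable_sphere_unif_norm)
    qed (use f_bound in auto)
    moreover have "c\<^sup>2 * (infdist y X)\<^sup>2 * indicator (- B) \<theta> \<le> f \<theta> y" for \<theta>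
    proof (rule f_ge)
      fix x assume x: "x \<in> X"
      show "c\<^sup>2 * (infdist y X)\<^sup>2 * indicator (- B) \<theta> \<le> ((y - x) \<bullet> \<theta>)\<^sup>2"
      proof (cases "\<theta> \<in> B")
        case False
        then have "c * norm (y - x) \<le> \<bar>\<theta> \<bullet> (y - x)\<bar>" using x by (auto simp: B_def not_less)
        moreover have "c * infdist y X \<le> c * norm (y - x)"
          using infdist_le[OF x, of y] c(1) by (simp add: dist_norm)
        ultimately have "c * infdist y X \<le> \<bar>\<theta> \<bullet> (y - x)\<bar>" by (rule order_trans[rotated])
        then have "(c * infdist y X)\<^sup>2 \<le> \<bar>\<theta> \<bullet> (y - x)\<bar>\<^sup>2"
          using c(1) by (intro power_mono) (auto simp: infdist_nonneg)
        then show ?thesis using False by (simp add: power_mult_distrib inner_commute)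
      qed simp
    qed
    ultimately have "(\<integral>\<theta>. c\<^sup>2 * (infdist y X)\<^sup>2 * indicator (- B) \<theta> \<partial>sphere_unif) \<le> (\<integral>\<theta>. f \<theta> y \<partial>sphere_unif)"
      by (intro integral_mono integrable_mult_right) (auto simp: S.emeasure_eq_measure)
    moreover have "1 / 2 \<le> measure sphere_unif (- B)"
      using c(2)[of "(\<lambda>x. y - x) ` X", folded B_def] X(1) card_image_le[OF X(1)] S.prob_compl[of B] B
      by (auto simp: Compl_eq_Diff_UNIV)
    then have "c\<^sup>2 * (infdist y X)\<^sup>2 * (1 / 2) \<le> c\<^sup>2 * (infdist y X)\<^sup>2 * measure sphere_unif (- B)"
      by (intro mult_left_mono) auto
    ultimately show ?thesis by simp
  qed
  show ?thesis
  \<comment> \<open>The good directions have measure at least 1/2 and lose at most the factor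
    \<open>c\<^sup>2\<close>.\<close>
  proof (rule that[of "2 / c\<^sup>2"])
    show "0 < 2 / c\<^sup>2" using c(1) by simp
    fix \<nu> :: "'a measure" assume \<nu>: "\<nu> \<in> P2"
    interpret \<nu>: prob_space \<nu> using \<nu> P2D by auto
    have s[measurable_cong]: "sets \<nu> = sets borel" using \<nu> P2D by auto
    have iw: "integrable \<nu> (\<lambda>y. (norm (y - x0))\<^sup>2)"
      using P2D(4)[OF \<nu>] by (intro P2_square_integrable_diff) auto
    note F = \<nu>.prob_space_axioms s f_meas iw f_bound
    have [measurable]: "(\<lambda>y. infdist y X) \<in> borel_measurable borel"
      by (intro borel_measurable_continuous_onI continuous_on_infdist continuous_on_id)
    show i: "integrable \<nu> (\<lambda>y. (infdist y X)\<^sup>2)"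
    proof (rule Bochner_Integration.integrable_bound[OF iw])
      show "AE y in \<nu>. norm ((infdist y X)\<^sup>2) \<le> norm ((norm (y - x0))\<^sup>2)"
        using infdist_le[OF x0] by (auto simp: dist_norm infdist_nonneg intro!: power_mono)
    qed measurable
    have "(\<integral>y. f \<theta> y \<partial>\<nu>) \<le> 1 * (W (proj \<theta> \<mu>) (proj \<theta> \<nu>))\<^sup>2" for \<theta>
    proof -
      let ?\<psi> = "\<lambda>z. Min ((\<lambda>x. (z - x \<bullet> \<theta>)\<^sup>2) ` X)"
      have [measurable]: "?\<psi> \<in> borel_measurable borel" using X(1) by measurable
      have "f \<theta> y = ?\<psi> (y \<bullet> \<theta>)" for y by (simp add: f_def inner_diff_left)
      then have eq: "integral\<^sup>L (proj \<theta> \<nu>) ?\<psi> = (\<integral>y. f \<theta> y \<partial>\<nu>)" "integrable (proj \<theta> \<nu>) ?\<psi>"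
        using sphere_unif_integrable_inner[OF F, of \<theta>] by (simp_all add: integral_proj[OF s])
      have "integral\<^sup>L (proj \<theta> \<mu>) (\<lambda>_. 0) + integral\<^sup>L (proj \<theta> \<nu>) ?\<psi> \<le> 1 * (W (proj \<theta> \<mu>) (proj \<theta> \<nu>))\<^sup>2"
      proof (intro W_dual proj_P2 \<mu> \<nu> eq(2))
        \<comment> \<open>The pair consisting of 0 and \<open>?\<psi>\<close> is admissible because
          \<open>z\<close> is itself one of the points over which the minimum is taken.\<close>
        show "AE z in proj \<theta> \<mu>. \<forall>z'. 0 + ?\<psi> z' \<le> 1 * (dist z z')\<^sup>2"
          using AE_proj_finite[OF P2D(2)[OF \<mu>] X(1,3), of \<theta>]
        proof eventually_elim
          case (elim z)
          then obtain x where x: "x \<in> X" "z = x \<bullet> \<theta>" by blast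
          have "?\<psi> z' \<le> (z' - x \<bullet> \<theta>)\<^sup>2" for z' using X(1) x(1) by (intro Min_le) auto
          then show ?case using x by (simp add: dist_real_def power2_commute)
        qed
      qed auto
      then show ?thesis by (simp add: eq)
    qed
    then have "(\<integral>\<theta>. (\<integral>y. f \<theta> y \<partial>\<nu>) \<partial>sphere_unif) \<le> 1 * (SW \<mu> \<nu>)\<^sup>2"
      using sphere_unif_integrable_fst[OF F] by (intro integral_le_SW \<mu> \<nu>) auto
    moreover have "(\<integral>y. c\<^sup>2 / 2 * (infdist y X)\<^sup>2 \<partial>\<nu>) \<le> (\<integral>y. (\<integral>\<theta>. f \<theta> y \<partial>sphere_unif) \<partial>\<nu>)"
      using i sphere_unif_integrable_snd[OF F] lower by (intro integral_mono) auto
    ultimately have "c\<^sup>2 / 2 * (\<integral>y. (infdist y X)\<^sup>2 \<partial>\<nu>) \<le> (SW \<mu> \<nu>)\<^sup>2"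
      by (simp add: sphere_unif_Fubini[OF F])
    then show "(\<integral>y. (infdist y X)\<^sup>2 \<partial>\<nu>) \<le> 2 / c\<^sup>2 * (SW \<mu> \<nu>)\<^sup>2"
      using c(1) by (simp add: field_simps)
  qed
qed

section \<open>Slope bounds for potentials with bounded continuous gradient\<close>

definition gradient_norm :: "('a::euclidean_space \<Rightarrow> 'a) \<Rightarrow> 'a measure \<Rightarrow> real" where
  "gradient_norm g \<mu> = sqrt (\<integral>x. (norm (g x))\<^sup>2 \<partial>\<mu>)"

locale bounded_C1_potential =
  fixes V :: "'a::euclidean_space \<Rightarrow> real" and g :: "'a \<Rightarrow> 'a" and L :: real
  assumes der: "\<And>x. GDERIV V x :> g x"
    and cont_g: "continuous_on UNIV g"
    and L_pos: "0 < L"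
    and norm_g_le: "\<And>x. norm (g x) \<le> L"
begin

section \<open>Lipschitz and Taylor estimates\<close>

lemma has_derivative: "(V has_derivative (\<lambda>h. h \<bullet> g x)) (at x within S)"
  using der[of x] by (auto simp: gderiv_def intro: has_derivative_at_withinI)

lemma lipschitz: "\<bar>V y - V x\<bar> \<le> L * norm (y - x)"
proof -
  have "norm (V y - V x) \<le> L * norm (y - x)"
  proof (rule differentiable_bound[of UNIV])
    show "onorm (\<lambda>h. h \<bullet> g z) \<le> L" for z
    proof (rule onorm_le)
      show "norm (h \<bullet> g z) \<le> L * norm h" for h
        using Cauchy_Schwarz_ineq2[of h "g z"] mult_left_mono[OF norm_g_le[of z] norm_ge_zero[of h]]
        by (simp add: mult.commute)
    qed
  qed (auto intro: has_derivative)
  then show ?thesis by simp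
qed

lemma continuous_V: "continuous_on UNIV V"
  using has_derivative by (metis differentiable_imp_continuous_on differentiable_on_def differentiableI)

lemma measurable_V [measurable]: "V \<in> borel_measurable borel"
  using continuous_V by (rule borel_measurable_continuous_onI)

lemma measurable_g [measurable]: "g \<in> borel_measurable borel"
  using cont_g by (rule borel_measurable_continuous_onI)

lemma taylor:
  assumes "convex S" "x \<in> S" "y \<in> S" "\<And>z. z \<in> S \<Longrightarrow> norm (g z - g x) \<le> \<epsilon>"
  shows "\<bar>V y - V x - (y - x) \<bullet> g x\<bar> \<le> \<epsilon> * norm (y - x)"
proof -
  have "norm (V y - V x - (\<lambda>h. h \<bullet> g x) (y - x)) \<le> norm (y - x) * \<epsilon>"
  proof (rule differentiable_bound_linearization[where f' = "\<lambda>z h. h \<bullet> g z"])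
    show "x + t *\<^sub>R (y - x) \<in> S" if "t \<in> {0..1}" for t
      using assms(1-3) that convex_alt[of S] by (auto simp: algebra_simps)
    show "onorm ((\<lambda>h. h \<bullet> g z) - (\<lambda>h. h \<bullet> g x)) \<le> \<epsilon>" if "z \<in> S" for z
      unfolding fun_diff_def
    proof (rule onorm_le)
      show "norm (h \<bullet> g z - h \<bullet> g x) \<le> \<epsilon> * norm h" for h
        using Cauchy_Schwarz_ineq2[of h "g z - g x"] mult_left_mono[OF assms(4)[OF that] norm_ge_zero[of h]]
        by (simp add: mult.commute inner_diff_right)
    qed
  qed (use assms(2) in \<open>auto intro: has_derivative\<close>)
  then show ?thesis by (simp add: mult.commute)
qed

text \<open>Continuity of \<open>g\<close> is uniform on compact sets, so base points are confined
  to a ball. The radius \<open>R + 1\<close> and the cap \<open>\<delta> \<le> 1\<close> leave room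
  for the segment from \<open>x\<close> to \<open>y\<close>.\<close>

lemma uniform_taylor:
  assumes "0 < \<epsilon>"
  obtains \<delta> where "0 < \<delta>"
    "\<And>x y. norm x \<le> R \<Longrightarrow> norm (y - x) < \<delta> \<Longrightarrow> \<bar>V y - V x - (y - x) \<bullet> g x\<bar> \<le> \<epsilon> * norm (y - x)"
proof -
  have "uniformly_continuous_on (cball 0 (R + 1)) g"
    using continuous_on_subset[OF cont_g] by (intro compact_uniformly_continuous) auto
  then obtain d where d: "0 < d"
    "\<And>x z. x \<in> cball 0 (R + 1) \<Longrightarrow> z \<in> cball 0 (R + 1) \<Longrightarrow> dist z x < d \<Longrightarrow> dist (g z) (g x) < \<epsilon>"
    using assms unfolding uniformly_continuous_on_def by blast
  show ?thesis
  proof (rule that[of "min d 1"])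
    fix x y :: 'a assume x: "norm x \<le> R" and y: "norm (y - x) < min d 1"
    show "\<bar>V y - V x - (y - x) \<bullet> g x\<bar> \<le> \<epsilon> * norm (y - x)"
    proof (rule taylor[of "ball x (min d 1)"])
      fix z assume z: "z \<in> ball x (min d 1)"
      have "norm z \<le> norm x + norm (z - x)" using norm_triangle_ineq[of x "z - x"] by simp
      then show "norm (g z - g x) \<le> \<epsilon>"
        using d(2)[of x z] x z by (auto simp: dist_norm norm_minus_commute)
    qed (use y d(1) in \<open>auto simp: dist_norm norm_minus_commute\<close>)
  qed (use d in auto)
qed

lemma integrable_V:
  assumes "\<mu> \<in> P2"
  shows "integrable \<mu> V"
proof -
  interpret prob_space \<mu> using assms P2D by auto
  have [measurable_cong]: "sets \<mu> = sets borel" using assms P2D by auto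
  have "integrable \<mu> (\<lambda>x. \<bar>V 0\<bar> + L * (1 + (norm x)\<^sup>2))" using P2D(4)[OF assms] by simp
  then show ?thesis
  proof (rule Bochner_Integration.integrable_bound)
    have "norm (V x) \<le> norm (\<bar>V 0\<bar> + L * (1 + (norm x)\<^sup>2))" for x
    proof -
      have "norm x \<le> 1 + (norm x)\<^sup>2"
        using sum_squares_bound[of 1 "norm x"] norm_ge_zero[of x] unfolding one_power2 by linarith
      then have "L * norm x \<le> L * (1 + (norm x)\<^sup>2)" using L_pos by simp
      then show ?thesis using lipschitz[of x 0] by simp
    qed
    then show "AE x in \<mu>. norm (V x) \<le> norm (\<bar>V 0\<bar> + L * (1 + (norm x)\<^sup>2))" by simp
  qed measurable
qed

lemma integrable_g:
  assumes "prob_space \<mu>" "sets \<mu> = sets borel"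
  shows "integrable \<mu> (\<lambda>x. (norm (g x))\<^sup>2)"
proof -
  interpret prob_space \<mu> by fact
  note [measurable_cong] = assms(2)
  show ?thesis
    using norm_g_le L_pos by (intro integrable_const_bound[where B = "L\<^sup>2"]) (auto intro!: power_mono)
qed

lemma gradient_norm_squared: "(gradient_norm g \<mu>)\<^sup>2 = (\<integral>x. (norm (g x))\<^sup>2 \<partial>\<mu>)"
  by (simp add: gradient_norm_def)

lemma gradient_norm_nonneg [simp]: "0 \<le> gradient_norm g \<mu>"
  by (simp add: gradient_norm_def)

section \<open>Slope bounds valid at every measure\<close>

text \<open>The pointwise bound
  \<open>V x - V y \<le> G n x * dist x y + K * (dist x y)\<^sup>2\<close> is split by Young's
  inequality into a potential in \<open>x\<close>, a potential in \<open>y\<close> and a quadratic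
  cost, so duality replaces the use of an optimal coupling. As \<open>n\<close> grows, the
  \<open>L\<^sup>2\<close> norm of \<open>G n\<close> tends to that of \<open>g\<close>.\<close>

lemma W_slope_le:
  assumes \<mu>: "\<mu> \<in> P2"
  shows "metric_slope P2 W (potential_energy V) \<mu> \<le> ennreal (gradient_norm g \<mu>)"
proof (rule metric_slope_le)
  interpret prob_space \<mu> using \<mu> P2D by auto
  have [measurable_cong]: "sets \<mu> = sets borel" using \<mu> P2D by auto
  let ?N = "gradient_norm g \<mu>"
  \<comment> \<open>\<open>1 / real (Suc n)\<close> is the Taylor error tolerated on the ball of
    radius \<open>n\<close>. Outside that ball Taylor is not uniform, and \<open>L\<close> is added
    so that the Lipschitz bound takes over.\<close>
  define G where "G n x = norm (g x) + 1 / real (Suc n) + L * indicator {x. real n < norm x} x" for n x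
  have [measurable]: "G n \<in> borel_measurable borel" for n
    unfolding G_def by measurable
  have G_pos: "0 < G n x" for n x
    unfolding G_def using L_pos by (simp add: add_nonneg_pos add_pos_nonneg)
  have G_le: "norm ((G n x)\<^sup>2) \<le> (2 * L + 1)\<^sup>2" for n x
  proof -
    have "1 / real (Suc n) \<le> 1" by simp
    moreover have "L * indicator {x. real n < norm x} x \<le> L" using L_pos by (simp add: indicator_def)
    ultimately have "G n x \<le> 2 * L + 1" unfolding G_def using norm_g_le[of x] by linarith
    then show ?thesis using G_pos[of n x] by (simp add: power_mono)
  qed
  have G_int: "integrable \<mu> (\<lambda>x. (G n x)\<^sup>2)" for n
    using G_le by (intro integrable_const_bound[where B = "(2 * L + 1)\<^sup>2"]) auto
  have lim: "(\<lambda>n. \<integral>x. (G n x)\<^sup>2 \<partial>\<mu>) \<longlonglongrightarrow> (\<integral>x. (norm (g x))\<^sup>2 \<partial>\<mu>)"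
  proof (rule integral_dominated_convergence[where w = "\<lambda>_. (2 * L + 1)\<^sup>2"])
    show "AE x in \<mu>. (\<lambda>n. (G n x)\<^sup>2) \<longlonglongrightarrow> (norm (g x))\<^sup>2"
    proof (rule AE_I2)
      fix x :: 'a
      obtain m :: nat where m: "norm x \<le> real m" using real_arch_simple by blast
      have "eventually (\<lambda>n. L * indicator {x. real n < norm x} x = 0) sequentially"
        using m by (intro eventually_sequentiallyI[of m]) (auto simp: indicator_def)
      then have "(\<lambda>n. L * indicator {x. real n < norm x} x) \<longlonglongrightarrow> 0" by (rule tendsto_eventually)
      moreover have "(\<lambda>n. 1 / real (Suc n)) \<longlonglongrightarrow> 0"
        using LIMSEQ_inverse_real_of_nat by (simp add: inverse_eq_divide)
      ultimately have "(\<lambda>n. G n x) \<longlonglongrightarrow> norm (g x) + 0 + 0"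
        unfolding G_def by (intro tendsto_intros)
      then show "(\<lambda>n. (G n x)\<^sup>2) \<longlonglongrightarrow> (norm (g x))\<^sup>2" by (auto intro: tendsto_power)
    qed
  qed (use G_le in auto)
  show "0 \<le> ?N" by simp
  show "0 \<le> W \<mu> \<nu>" for \<nu> by simp
  fix \<epsilon> :: real assume \<epsilon>: "0 < \<epsilon>"
  have "(\<integral>x. (norm (g x))\<^sup>2 \<partial>\<mu>) < (?N + \<epsilon> / 2)\<^sup>2"
    using \<epsilon> by (simp add: gradient_norm_squared[symmetric] power_strict_mono)
  then obtain n where n: "(\<integral>x. (G n x)\<^sup>2 \<partial>\<mu>) < (?N + \<epsilon> / 2)\<^sup>2"
    using order_tendstoD(2)[OF lim] by (auto simp: eventually_sequentially)
  obtain \<delta> where \<delta>: "0 < \<delta>" "\<And>x y. norm x \<le> real n \<Longrightarrow> norm (y - x) < \<delta> \<Longrightarrow>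
      \<bar>V y - V x - (y - x) \<bullet> g x\<bar> \<le> 1 / real (Suc n) * norm (y - x)"
    using uniform_taylor[of "1 / real (Suc n)" "real n"] by auto
  \<comment> \<open>At distance at least \<open>\<delta>\<close> the Lipschitz bound
    \<open>L * dist x y\<close> is below \<open>L / \<delta> * (dist x y)\<^sup>2\<close>.\<close>
  define K where "K = L / \<delta>"
  have K: "0 < K" using \<delta> L_pos by (simp add: K_def)
  have pw: "V x - V y \<le> G n x * dist x y + K * (dist x y)\<^sup>2" for x y
  proof -
    let ?r = "dist x y"
    have lip: "V x - V y \<le> L * ?r" using lipschitz[of x y] by (simp add: dist_norm)
    have nn: "0 \<le> (norm (g x) + 1 / real (Suc n)) * ?r" "0 \<le> K * ?r\<^sup>2" "0 \<le> G n x * ?r"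
      using K G_pos[of n x] by (simp_all add: add_nonneg_nonneg)
    consider "real n < norm x" | "\<delta> \<le> ?r" | "norm x \<le> real n" "?r < \<delta>" by linarith
    then show ?thesis
    proof cases
      case 1
      then have "G n x * ?r = (norm (g x) + 1 / real (Suc n)) * ?r + L * ?r"
        by (simp add: G_def algebra_simps)
      then show ?thesis using lip nn by linarith
    next
      case 2
      then have "L * ?r \<le> K * ?r\<^sup>2"
        using \<delta>(1) L_pos mult_right_mono[of \<delta> ?r ?r] by (simp add: K_def field_simps power2_eq_square)
      then show ?thesis using lip nn by linarith
    next
      case 3
      then have "V x - V y \<le> 1 / real (Suc n) * ?r - (y - x) \<bullet> g x"
        using \<delta>(2)[of x y] by (simp add: dist_norm norm_minus_commute abs_le_iff)
      moreover have "- ((y - x) \<bullet> g x) \<le> norm (g x) * ?r"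
        using Cauchy_Schwarz_ineq2[of "y - x" "g x"] by (simp add: dist_norm norm_minus_commute mult.commute)
      moreover have "1 / real (Suc n) * ?r + norm (g x) * ?r \<le> G n x * ?r"
        using 3 by (simp add: G_def distrib_right)
      ultimately show ?thesis using nn by linarith
    qed
  qed
  define A where "A = sqrt (\<integral>x. (G n x)\<^sup>2 \<partial>\<mu>)"
  have A2: "A\<^sup>2 = (\<integral>x. (G n x)\<^sup>2 \<partial>\<mu>)" by (simp add: A_def)
  \<comment> \<open>The summand \<open>1 / real (Suc n)\<close> keeps \<open>A\<close> positive even
    if \<open>g\<close> vanishes almost everywhere, as \<open>le_of_young\<close> requires.\<close>
  have A_pos: "0 < A"
  proof -
    have "(1 / real (Suc n))\<^sup>2 \<le> (G n x)\<^sup>2" for x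
      using L_pos by (intro power_mono) (auto simp: G_def)
    then have "(\<integral>x. (1 / real (Suc n))\<^sup>2 \<partial>\<mu>) \<le> (\<integral>x. (G n x)\<^sup>2 \<partial>\<mu>)"
      using G_int by (intro integral_mono) auto
    then have "(1 / real (Suc n))\<^sup>2 \<le> A\<^sup>2" by (simp add: A2 prob_space)
    then have "A\<^sup>2 \<noteq> 0" by (smt (verit) of_nat_Suc of_nat_0_le_iff zero_less_divide_1_iff zero_less_power)
    then show ?thesis unfolding A_def by (simp add: less_le)
  qed
  have A_le: "A \<le> ?N + \<epsilon> / 2"
    using n \<epsilon> unfolding A2[symmetric] by (auto intro!: power2_le_imp_le[of A])
  show "\<exists>e>0. \<forall>\<nu>\<in>P2. 0 < W \<mu> \<nu> \<longrightarrow> W \<mu> \<nu> < e \<longrightarrow>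
      potential_energy V \<mu> - potential_energy V \<nu> \<le> (?N + \<epsilon>) * W \<mu> \<nu>"
  proof (intro exI conjI ballI impI)
    \<comment> \<open>Within this radius the quadratic term costs at most
      \<open>\<epsilon> / 2\<close> times the distance; the other half was spent on
      \<open>A\<close>.\<close>
    show "0 < \<epsilon> / (2 * K)" using \<epsilon> K by simp
    fix \<nu> :: "'a measure" assume \<nu>: "\<nu> \<in> P2" and w: "0 < W \<mu> \<nu>" "W \<mu> \<nu> < \<epsilon> / (2 * K)"
    have "potential_energy V \<mu> - potential_energy V \<nu> \<le> A * W \<mu> \<nu> + K * (W \<mu> \<nu>)\<^sup>2"
    proof (rule le_of_young[OF A_pos w(1)])
      fix l :: real assume l: "0 < l"
      have "(\<integral>x. V x - (G n x)\<^sup>2 / (2 * l) \<partial>\<mu>) + (\<integral>y. - V y \<partial>\<nu>) \<le> (l / 2 + K) * (W \<mu> \<nu>)\<^sup>2"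
      proof (rule W_dual[OF \<mu> \<nu>])
        have "V x - (G n x)\<^sup>2 / (2 * l) + - V y \<le> (l / 2 + K) * (dist x y)\<^sup>2" for x y
          using pw[of x y] young_mult[OF l, of "G n x" "dist x y"] by (simp add: algebra_simps)
        then show "AE x in \<mu>. \<forall>y. V x - (G n x)\<^sup>2 / (2 * l) + - V y \<le> (l / 2 + K) * (dist x y)\<^sup>2" by simp
      qed (use integrable_V \<mu> \<nu> G_int l K in auto)
      then show "potential_energy V \<mu> - potential_energy V \<nu> \<le> A\<^sup>2 / (2 * l) + (l / 2 + K) * (W \<mu> \<nu>)\<^sup>2"
        using integrable_V[OF \<mu>] G_int by (simp add: potential_energy_def A2)
    qed
    also have "A * W \<mu> \<nu> \<le> (?N + \<epsilon> / 2) * W \<mu> \<nu>" using A_le by (intro mult_right_mono) auto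
    also have "K * (W \<mu> \<nu>)\<^sup>2 \<le> \<epsilon> / 2 * W \<mu> \<nu>"
      using w K by (simp add: field_simps power2_eq_square)
    finally show "potential_energy V \<mu> - potential_energy V \<nu> \<le> (?N + \<epsilon>) * W \<mu> \<nu>"
      by (simp add: algebra_simps)
  qed
qed

text \<open>The competitor is the pushforward of \<open>\<mu>\<close> under \<open>x \<mapsto> x - t g x\<close>.  Its second moment differs from
  that of \<open>\<mu>\<close> for all but one \<open>t > 0\<close>, which rules out \<open>SW \<mu> \<nu> = 0\<close>.\<close>

lemma slope_ge:
  fixes m :: "'a measure \<Rightarrow> 'a measure \<Rightarrow> real"
  assumes \<mu>: "\<mu> \<in> P2" and \<kappa>: "0 < \<kappa>"
    and m_nonneg: "\<And>\<nu>. 0 \<le> m \<mu> \<nu>"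
    and m_le: "\<And>\<nu>. \<nu> \<in> P2 \<Longrightarrow> \<kappa> * m \<mu> \<nu> \<le> W \<mu> \<nu>"
    and m_pos: "\<And>\<nu>. \<nu> \<in> P2 \<Longrightarrow> 0 < SW \<mu> \<nu> \<Longrightarrow> 0 < m \<mu> \<nu>"
  shows "ennreal (\<kappa> * gradient_norm g \<mu>) \<le> metric_slope P2 m (potential_energy V) \<mu>"
proof (rule metric_slope_ge)
  interpret prob_space \<mu> using \<mu> P2D by auto
  have s[measurable_cong]: "sets \<mu> = sets borel" using \<mu> P2D by auto
  let ?N = "gradient_norm g \<mu>"
  note ig = integrable_g[OF prob_space_axioms s]
  show "0 \<le> m \<mu> \<nu>" for \<nu> by (rule m_nonneg)
  fix \<epsilon> e :: real assume \<epsilon>: "0 < \<epsilon>" "\<epsilon> < \<kappa> * ?N" and e: "0 < e"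
  from \<epsilon> have "0 < \<kappa> * ?N" by linarith
  then have N: "0 < ?N" using \<kappa> by (simp add: zero_less_mult_iff)
  define t where "t n = 1 / real (Suc n)" for n
  have t_pos: "0 < t n" for n by (simp add: t_def)
  have t_lim: "t \<longlonglongrightarrow> 0"
    unfolding t_def using LIMSEQ_inverse_real_of_nat by (simp add: inverse_eq_divide)
  define T where "T n x = x - t n *\<^sub>R g x" for n x
  have [measurable]: "T n \<in> borel_measurable borel" for n unfolding T_def by measurable
  have iT: "integrable \<mu> (\<lambda>x. (norm (T n x))\<^sup>2)" for n
    unfolding T_def using ig P2D(4)[OF \<mu>]
    by (intro P2_square_integrable_diff) (auto simp: power_mult_distrib)
  define \<nu> where "\<nu> n = distr \<mu> borel (T n)" for n
  have \<nu>: "\<nu> n \<in> P2" for n unfolding \<nu>_def using iT by (intro distr_P2[OF \<mu>]) auto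
  have W: "W \<mu> (\<nu> n) \<le> t n * ?N" for n
  proof (rule power2_le_imp_le)
    have "(W \<mu> (\<nu> n))\<^sup>2 \<le> (\<integral>x. (dist x (T n x))\<^sup>2 \<partial>\<mu>)"
      unfolding \<nu>_def using iT by (intro W_distr_le[OF \<mu>]) auto
    also have "\<dots> = (\<integral>x. (t n)\<^sup>2 * (norm (g x))\<^sup>2 \<partial>\<mu>)"
      using t_pos by (simp add: T_def dist_norm power_mult_distrib)
    finally show "(W \<mu> (\<nu> n))\<^sup>2 \<le> (t n * ?N)\<^sup>2"
      by (simp add: power_mult_distrib gradient_norm_squared)
    show "0 \<le> t n * ?N" using t_pos[of n] N by simp
  qed
  have m_lt: "m \<mu> (\<nu> n) \<le> t n * ?N / \<kappa>" for n
    using m_le[OF \<nu>[of n]] W[of n] \<kappa> by (simp add: field_simps)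

  have D_lim: "(\<lambda>n. \<integral>x. (V x - V (T n x)) / t n \<partial>\<mu>) \<longlonglongrightarrow> (\<integral>x. (norm (g x))\<^sup>2 \<partial>\<mu>)"
  proof (rule integral_dominated_convergence[where w = "\<lambda>_. L\<^sup>2"])
    show "AE x in \<mu>. (\<lambda>n. (V x - V (T n x)) / t n) \<longlonglongrightarrow> (norm (g x))\<^sup>2"
    proof (rule AE_I2)
      fix x
      have "((\<lambda>r. V (x + r *\<^sub>R (- g x))) has_derivative (\<lambda>h. (h *\<^sub>R (- g x)) \<bullet> g x)) (at 0)"
        by (rule has_derivative_compose[where f = "\<lambda>r. x + r *\<^sub>R (- g x)" and g = V, simplified comp_def])
          (auto intro!: derivative_eq_intros has_derivative[THEN has_derivative_eq_rhs])
      then have "((\<lambda>r. V (x + r *\<^sub>R (- g x))) has_real_derivative - (norm (g x))\<^sup>2) (at 0)"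
        unfolding has_field_derivative_def
        by (rule has_derivative_eq_rhs) (simp add: power2_norm_eq_inner fun_eq_iff)
      then have "((\<lambda>r. (V (x + r *\<^sub>R (- g x)) - V x) / r) \<longlongrightarrow> - (norm (g x))\<^sup>2) (at 0)"
        by (simp add: DERIV_def)
      moreover have "filterlim t (at 0) sequentially"
        using t_lim t_pos by (auto simp: filterlim_at intro!: always_eventually less_imp_neq[THEN not_sym])
      ultimately have "(\<lambda>n. (V (x + t n *\<^sub>R (- g x)) - V x) / t n) \<longlonglongrightarrow> - (norm (g x))\<^sup>2"
        by (rule filterlim_compose)
      then have "(\<lambda>n. - ((V (x + t n *\<^sub>R (- g x)) - V x) / t n)) \<longlonglongrightarrow> - (- (norm (g x))\<^sup>2)"
        by (rule tendsto_minus)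
      then show "(\<lambda>n. (V x - V (T n x)) / t n) \<longlonglongrightarrow> (norm (g x))\<^sup>2"
        by (simp add: T_def minus_divide_left)
    qed
    show "AE x in \<mu>. norm ((V x - V (T n x)) / t n) \<le> L\<^sup>2" for n
    proof (rule AE_I2)
      fix x
      have "\<bar>V x - V (T n x)\<bar> \<le> L * norm (x - T n x)" by (rule lipschitz)
      also have "\<dots> = L * (t n * norm (g x))" using t_pos[of n] by (simp add: T_def)
      also have "\<dots> \<le> L * (t n * L)"
        using L_pos t_pos[of n] norm_g_le[of x] by (intro mult_left_mono) auto
      finally show "norm ((V x - V (T n x)) / t n) \<le> L\<^sup>2"
        using t_pos[of n] by (simp add: field_simps power2_eq_square)
    qed
  qed auto
  have D: "(\<integral>x. (V x - V (T n x)) / t n \<partial>\<mu>) = (potential_energy V \<mu> - potential_energy V (\<nu> n)) / t n" for n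
  proof -
    have "integrable \<mu> (\<lambda>x. V (T n x))"
      using integrable_V[OF \<nu>[of n]] by (simp add: \<nu>_def integrable_distr_eq)
    then show ?thesis
      using integrable_V[OF \<mu>] by (simp add: potential_energy_def \<nu>_def integral_distr)
  qed
  \<comment> \<open>The threshold is \<open>(\<kappa> * ?N - \<epsilon>) * (?N / \<kappa>)\<close>:
    the required quotient multiplied by the bound on the distance per unit of
    \<open>t n\<close>.\<close>
  have "?N\<^sup>2 - \<epsilon> * ?N / \<kappa> < (\<integral>x. (norm (g x))\<^sup>2 \<partial>\<mu>)"
    using \<epsilon> N \<kappa> by (simp add: gradient_norm_squared[symmetric])
  from order_tendstoD(1)[OF D_lim[unfolded D] this]
  have ev1: "\<forall>\<^sub>F n in sequentially. ?N\<^sup>2 - \<epsilon> * ?N / \<kappa> < (potential_energy V \<mu> - potential_energy V (\<nu> n)) / t n" .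

  have "(\<lambda>n. t n * ?N / \<kappa>) \<longlonglongrightarrow> 0 * ?N / \<kappa>"
    using \<kappa> by (intro tendsto_intros t_lim) auto
  from order_tendstoD(2)[OF this, of e]
  have ev2: "\<forall>\<^sub>F n in sequentially. t n * ?N / \<kappa> < e" using e by simp

  define B where "B = (\<integral>x. x \<bullet> g x \<partial>\<mu>)"
  have iB: "integrable \<mu> (\<lambda>x. x \<bullet> g x)"
  proof (rule Bochner_Integration.integrable_bound)
    show "integrable \<mu> (\<lambda>x. (norm x)\<^sup>2 + (norm (g x))\<^sup>2)" using ig P2D(4)[OF \<mu>] by simp
    have "norm (x \<bullet> g x) \<le> norm ((norm x)\<^sup>2 + (norm (g x))\<^sup>2)" for x
      using Cauchy_Schwarz_ineq2[of x "g x"] sum_squares_bound[of "norm x" "norm (g x)"]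
        mult_nonneg_nonneg[OF norm_ge_zero[of x] norm_ge_zero[of "g x"]]
      by simp
    then show "AE x in \<mu>. norm (x \<bullet> g x) \<le> norm ((norm x)\<^sup>2 + (norm (g x))\<^sup>2)" by simp
  qed measurable
  have M: "(\<integral>x. (norm x)\<^sup>2 \<partial>(\<nu> n)) = (\<integral>x. (norm x)\<^sup>2 \<partial>\<mu>) - 2 * t n * B + (t n)\<^sup>2 * ?N\<^sup>2" for n
  proof -
    have "(\<integral>x. (norm x)\<^sup>2 \<partial>(\<nu> n)) = (\<integral>x. (norm (T n x))\<^sup>2 \<partial>\<mu>)"
      unfolding \<nu>_def by (simp add: integral_distr)
    also have "\<dots> = (\<integral>x. (norm x)\<^sup>2 - 2 * t n * (x \<bullet> g x) + (t n)\<^sup>2 * (norm (g x))\<^sup>2 \<partial>\<mu>)"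
      unfolding T_def power2_norm_eq_inner
      by (simp add: inner_diff_left inner_diff_right inner_commute power2_eq_square algebra_simps)
    also have "\<dots> = (\<integral>x. (norm x)\<^sup>2 \<partial>\<mu>) - 2 * t n * B + (t n)\<^sup>2 * ?N\<^sup>2"
      using ig iB P2D(4)[OF \<mu>] by (simp add: B_def gradient_norm_squared)
    finally show ?thesis .
  qed
  \<comment> \<open>The second moments agree exactly at the parameter
    \<open>2 * B / ?N\<^sup>2\<close>. If \<open>B = 0\<close> this is 0 and never attained;
    otherwise \<open>t n\<close> leaves it behind on its way to 0.\<close>
  have ev3: "\<forall>\<^sub>F n in sequentially. t n \<noteq> 2 * B / ?N\<^sup>2"
  proof (cases "B = 0")
    case True
    then show ?thesis using t_pos by (auto intro!: always_eventually less_imp_neq[THEN not_sym])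
  next
    case False
    then show ?thesis using N by (intro tendsto_imp_eventually_ne[OF t_lim]) auto
  qed
  obtain n where n: "?N\<^sup>2 - \<epsilon> * ?N / \<kappa> < (potential_energy V \<mu> - potential_energy V (\<nu> n)) / t n"
    "t n * ?N / \<kappa> < e" "t n \<noteq> 2 * B / ?N\<^sup>2"
    using eventually_conj[OF ev1 eventually_conj[OF ev2 ev3]] by (auto simp: eventually_sequentially)
  have "SW \<mu> (\<nu> n) \<noteq> 0"
  proof
    assume "SW \<mu> (\<nu> n) = 0"
    from SW_eq_0_second_moment[OF \<mu> \<nu> this] have "(t n)\<^sup>2 * ?N\<^sup>2 - 2 * t n * B = 0"
      unfolding M by linarith
    moreover have "(t n)\<^sup>2 * ?N\<^sup>2 - 2 * t n * B = t n * (t n * ?N\<^sup>2 - 2 * B)"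
      by (simp add: power2_eq_square algebra_simps)
    ultimately have "t n * (t n * ?N\<^sup>2 - 2 * B) = 0" by simp
    with n(3) t_pos[of n] N show False by (auto simp: field_simps)
  qed
  then have "0 < SW \<mu> (\<nu> n)" using SW_nonneg[of \<mu> "\<nu> n"] by linarith
  then have "0 < m \<mu> (\<nu> n)" by (rule m_pos[OF \<nu>])
  moreover have "m \<mu> (\<nu> n) < e" using m_lt[of n] n(2) by linarith
  moreover have "(\<kappa> * ?N - \<epsilon>) * m \<mu> (\<nu> n) \<le> potential_energy V \<mu> - potential_energy V (\<nu> n)"
  proof -
    have "(\<kappa> * ?N - \<epsilon>) * m \<mu> (\<nu> n) \<le> (\<kappa> * ?N - \<epsilon>) * (t n * ?N / \<kappa>)"
      using m_lt[of n] \<epsilon> by (intro mult_left_mono) auto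
    also have "\<dots> = t n * (?N\<^sup>2 - \<epsilon> * ?N / \<kappa>)"
      using \<kappa> by (simp add: field_simps power2_eq_square)
    also have "\<dots> \<le> potential_energy V \<mu> - potential_energy V (\<nu> n)"
      using n(1) t_pos[of n] by (simp add: pos_less_divide_eq mult.commute)
    finally show ?thesis .
  qed
  ultimately show "\<exists>v\<in>P2. 0 < m \<mu> v \<and> m \<mu> v < e \<and>
      (\<kappa> * ?N - \<epsilon>) * m \<mu> v \<le> potential_energy V \<mu> - potential_energy V v"
    using \<nu> by blast
qed

lemma SW_slope_ge:
  assumes "\<mu> \<in> P2"
  shows "ennreal (sqrt DIM('a) * gradient_norm g \<mu>) \<le> metric_slope P2 SW (potential_energy V) \<mu>"
  using SW_le_W assms by (intro slope_ge) auto

lemma W_slope_eq: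
  assumes \<mu>: "\<mu> \<in> P2"
  shows "metric_slope P2 W (potential_energy V) \<mu> = ennreal (gradient_norm g \<mu>)"
proof (rule antisym[OF W_slope_le[OF \<mu>]])
  have "0 < W \<mu> \<nu>" if \<nu>: "\<nu> \<in> P2" and "0 < SW \<mu> \<nu>" for \<nu>
    using SW_le_W[OF \<mu> \<nu>] that(2) by (smt (verit) DIM_positive of_nat_0_less_iff mult_pos_pos real_sqrt_gt_zero)
  then have "ennreal (1 * gradient_norm g \<mu>) \<le> metric_slope P2 W (potential_energy V) \<mu>"
    by (intro slope_ge[OF \<mu>]) auto
  then show "ennreal (gradient_norm g \<mu>) \<le> metric_slope P2 W (potential_energy V) \<mu>" by simp
qed

end

section \<open>Finitely supported measures\<close>

text \<open>Encodes a choice as a sum: if the projected atoms are \<open>\<rho>\<close>-separated,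
  at most one term survives, the one of the atom whose cell contains \<open>z\<close>, and outside
  all cells the value is 0. In this form it is defined for every \<open>\<theta>\<close>, and joint
  measurability in \<open>\<theta>\<close> and \<open>z\<close> is immediate.\<close>

definition cell_sum :: "'a::euclidean_space set \<Rightarrow> real \<Rightarrow> 'a \<Rightarrow> real \<Rightarrow> ('a \<Rightarrow> real) \<Rightarrow> real" where
  "cell_sum X \<rho> \<theta> z h = (\<Sum>x\<in>X. if \<bar>z - x \<bullet> \<theta>\<bar> < \<rho> / 2 then h x else 0)"

definition separated :: "'a::euclidean_space set \<Rightarrow> real \<Rightarrow> 'a \<Rightarrow> bool" where
  "separated X \<rho> \<theta> \<longleftrightarrow> (\<forall>x\<in>X. \<forall>x'\<in>X. x \<noteq> x' \<longrightarrow> \<rho> \<le> \<bar>x \<bullet> \<theta> - x' \<bullet> \<theta>\<bar>)"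

lemma cell_sum_eq:
  assumes "finite X" "separated X \<rho> \<theta>" "x \<in> X" "\<bar>z - x \<bullet> \<theta>\<bar> < \<rho> / 2"
  shows "cell_sum X \<rho> \<theta> z h = h x"
proof -
  have "(if \<bar>z - x' \<bullet> \<theta>\<bar> < \<rho> / 2 then h x' else 0) = (if x' = x then h x' else 0)" if "x' \<in> X" for x'
  proof (cases "x' = x")
    case False
    then have "\<rho> \<le> \<bar>x \<bullet> \<theta> - x' \<bullet> \<theta>\<bar>" using assms that by (auto simp: separated_def)
    then have "\<not> \<bar>z - x' \<bullet> \<theta>\<bar> < \<rho> / 2" using assms(4) by linarith
    then show ?thesis using False by simp
  qed (use assms in simp)
  then have "cell_sum X \<rho> \<theta> z h = (\<Sum>x'\<in>X. if x' = x then h x' else 0)"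
    unfolding cell_sum_def by (intro sum.cong) auto
  then show ?thesis using assms by (simp add: sum.delta)
qed

lemma abs_cell_sum_le:
  assumes "\<And>x. x \<in> X \<Longrightarrow> \<bar>z - x \<bullet> \<theta>\<bar> < \<rho> / 2 \<Longrightarrow> \<bar>h x\<bar> \<le> B x" "\<And>x. x \<in> X \<Longrightarrow> 0 \<le> B x"
  shows "\<bar>cell_sum X \<rho> \<theta> z h\<bar> \<le> (\<Sum>x\<in>X. B x)"
  unfolding cell_sum_def using assms by (intro order_trans[OF sum_abs] sum_mono) auto

text \<open>Each nonzero difference of two atoms spoils only a thin slab of directions, and there
  are finitely many differences. Intersecting with the sphere costs no measure and makes
  \<open>norm \<theta> = 1\<close> hold throughout \<open>\<Theta>\<close>.\<close>

lemma good_directions: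
  fixes X :: "'a::euclidean_space set"
  assumes X: "finite X" and "0 < \<eta>"
  obtains \<rho> \<Theta> where "0 < \<rho>" "\<Theta> \<in> sets borel" "1 - \<eta> \<le> measure sphere_unif \<Theta>"
    "\<And>\<theta>. \<theta> \<in> \<Theta> \<Longrightarrow> norm \<theta> = 1" "\<And>\<theta>. \<theta> \<in> \<Theta> \<Longrightarrow> separated X \<rho> \<theta>"
proof -
  interpret prob_space "sphere_unif :: 'a measure" by (rule sphere_unif_prob_space)
  define U where "U = (\<lambda>(x, x'). x - x') ` (X \<times> X) - {0}"
  have U: "finite U" using X by (simp add: U_def)
  obtain c where c: "0 < c"
    "\<And>U :: 'a set. finite U \<Longrightarrow> card U \<le> card (X \<times> X) \<Longrightarrow>
      measure sphere_unif {\<theta>. \<exists>u\<in>U. \<bar>\<theta> \<bullet> u\<bar> < c * norm u} \<le> \<eta>"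
    using sphere_unif_slabs[of \<eta> "card (X \<times> X)"] assms by auto
  have "card U \<le> card ((\<lambda>(x, x'). x - x') ` (X \<times> X))" unfolding U_def using X by (intro card_mono) auto
  also have "\<dots> \<le> card (X \<times> X)" using X by (intro card_image_le) auto
  finally have cU: "card U \<le> card (X \<times> X)" .
  \<comment> \<open>The added 1 keeps the minimum meaningful when no two atoms differ and
    \<open>U\<close> is empty.\<close>
  define s where "s = Min (insert 1 (norm ` U))"
  have s: "0 < s" unfolding s_def using U by (subst Min_gr_iff) (auto simp: U_def)
  have s_le: "s \<le> norm u" if "u \<in> U" for u unfolding s_def using U that by (intro Min_le) auto
  define B where "B = {\<theta>. \<exists>u\<in>U. \<bar>\<theta> \<bullet> u\<bar> < c * norm u}"
  have B: "B \<in> sets borel" unfolding B_def by (rule borel_slabs)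
  have sph: "sphere 0 1 \<in> sets (borel :: 'a measure)" by (intro borel_closed closed_sphere)
  show ?thesis
  proof (rule that[of "c * s" "sphere 0 1 - B"])
    show "0 < c * s" using c s by simp
    show "sphere 0 1 - B \<in> sets borel" using B sph by auto
    have "measure sphere_unif (sphere 0 1 - B) = measure sphere_unif (- B)"
      using sphere_unif_sphere B sph by (intro measure_eq_AE) (auto elim!: eventually_mono)
    also have "\<dots> = 1 - measure sphere_unif B"
      using prob_compl[of B] B by (simp add: Compl_eq_Diff_UNIV)
    finally show "1 - \<eta> \<le> measure sphere_unif (sphere 0 1 - B)"
      using c(2)[OF U cU] by (simp add: B_def)
    fix \<theta> assume \<theta>: "\<theta> \<in> sphere 0 1 - B"
    then show "norm \<theta> = 1" by simp
    show "separated X (c * s) \<theta>"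
      unfolding separated_def
    proof (intro ballI impI)
      fix x x' assume "x \<in> X" "x' \<in> X" "x \<noteq> x'"
      then have u: "x - x' \<in> U" by (auto simp: U_def)
      have "c * s \<le> c * norm (x - x')" using s_le[OF u] c(1) by simp
      also have "\<dots> \<le> \<bar>\<theta> \<bullet> (x - x')\<bar>" using \<theta> u by (auto simp: B_def not_less)
      finally show "c * s \<le> \<bar>x \<bullet> \<theta> - x' \<bullet> \<theta>\<bar>" by (simp add: inner_diff_right inner_commute)
    qed
  qed
qed

context bounded_C1_potential
begin

text \<open>On the lines \<open>\<real>\<theta>\<close> with \<open>\<theta>\<close> in a set \<open>\<Theta>\<close> of almost full measure \<open>p\<close>, the projections of the atoms
  are \<open>\<rho>\<close>-separated, and near each of them \<open>- V\<close> is replaced by a one-dimensional affine function.  The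
  slope \<open>d (g x \<bullet> \<theta>)\<close> is chosen so that averaging over \<open>\<theta>\<close> gives back \<open>g x\<close>.\<close>

lemma sliced_competitor:
  assumes \<mu>: "\<mu> \<in> P2" and X: "finite X" "X \<noteq> {}" "AE x in \<mu>. x \<in> X" and \<epsilon>: "0 < \<epsilon>"
  obtains U C K where "0 < C" "0 < K" "\<And>\<nu>. \<nu> \<in> P2 \<Longrightarrow> integrable \<nu> U"
    "\<And>\<nu> l. \<nu> \<in> P2 \<Longrightarrow> 0 < l \<Longrightarrow> potential_energy V \<mu> + (\<integral>y. U y \<partial>\<nu>)
      \<le> DIM('a) * (gradient_norm g \<mu>)\<^sup>2 / (2 * l) + (l / 2 + C) * (SW \<mu> \<nu>)\<^sup>2"
    "\<And>y. \<bar>V y + U y\<bar> \<le> \<epsilon> * infdist y X + K * (infdist y X)\<^sup>2"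
proof -
  interpret S: prob_space "sphere_unif :: 'a measure" by (rule sphere_unif_prob_space)
  let ?d = "real DIM('a)"
  have d: "0 < ?d" by simp
  \<comment> \<open>The bound 1/2 keeps \<open>p\<close> positive; the second bound limits to
    \<open>\<epsilon> / 2\<close> the first-order error from the directions outside
    \<open>\<Theta>\<close>.\<close>
  define \<eta> where "\<eta> = min (1 / 2) (\<epsilon> / (2 * ?d * L))"
  have \<eta>: "0 < \<eta>" "\<eta> \<le> 1 / 2" "?d * L * \<eta> \<le> \<epsilon> / 2"
    using \<epsilon> L_pos d by (auto simp: \<eta>_def min_def field_simps)
  obtain \<rho> \<Theta> where \<rho>: "0 < \<rho>" and \<Theta>[measurable]: "\<Theta> \<in> sets borel"
    and p_ge: "1 - \<eta> \<le> measure sphere_unif \<Theta>"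
    and norm\<Theta>: "\<And>\<theta>. \<theta> \<in> \<Theta> \<Longrightarrow> norm \<theta> = 1" and sep: "\<And>\<theta>. \<theta> \<in> \<Theta> \<Longrightarrow> separated X \<rho> \<theta>"
    using good_directions[OF X(1) \<eta>(1)] by metis
  define p where "p = measure sphere_unif \<Theta>"
  have p: "0 < p" "1 - \<eta> \<le> p" "p \<le> 1"
    using p_ge \<eta> S.prob_le_1[of \<Theta>] unfolding p_def by auto
  \<comment> \<open>Dividing by \<open>p\<close> makes the constant part average over
    \<open>\<Theta>\<close> to exactly \<open>- V x\<close>. The linear part is not rescaled; what
    it misses outside \<open>\<Theta>\<close> is absorbed by \<open>\<eta>\<close>.\<close>
  define u where "u \<theta> z = cell_sum X \<rho> \<theta> z (\<lambda>x. - (V x / p) - ?d * (g x \<bullet> \<theta>) * (z - x \<bullet> \<theta>))" for \<theta> z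
  \<comment> \<open>The partner of \<open>u\<close> at the atoms: it cancels the constant
    \<open>V x / p\<close> and subtracts the Young remainder of the slope
    \<open>?d * (g x \<bullet> \<theta>)\<close>.\<close>
  define b where "b l \<theta> z = cell_sum X \<rho> \<theta> z (\<lambda>x. V x / p - (?d * (g x \<bullet> \<theta>))\<^sup>2 / (2 * l))" for l \<theta> z
  have u_meas[measurable]: "case_prod u \<in> borel_measurable (borel \<Otimes>\<^sub>M borel)"
    unfolding u_def cell_sum_def by measurable
  have b_meas[measurable]: "case_prod (b l) \<in> borel_measurable (borel \<Otimes>\<^sub>M borel)" for l
    unfolding b_def cell_sum_def by measurable
  define M where "M = (\<Sum>x\<in>X. \<bar>V x\<bar> / p + ?d * L * (\<rho> / 2))"
  have M_nn: "0 \<le> \<bar>V x\<bar> / p + ?d * L * (\<rho> / 2)" for x using p \<rho> L_pos by (simp add: add_nonneg_nonneg)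
  have gx: "\<bar>g x \<bullet> \<theta>\<bar> \<le> L" if "norm \<theta> = 1" for x \<theta>
    using Cauchy_Schwarz_ineq2[of "g x" \<theta>] norm_g_le[of x] that by simp
  have u_le: "\<bar>u \<theta> z\<bar> \<le> M" if \<theta>: "norm \<theta> = 1" for \<theta> z
    unfolding u_def M_def
  proof (rule abs_cell_sum_le[OF _ M_nn])
    fix x assume z: "\<bar>z - x \<bullet> \<theta>\<bar> < \<rho> / 2"
    have "\<bar>- (V x / p) - ?d * (g x \<bullet> \<theta>) * (z - x \<bullet> \<theta>)\<bar> \<le> \<bar>V x / p\<bar> + \<bar>?d * (g x \<bullet> \<theta>) * (z - x \<bullet> \<theta>)\<bar>"
      by linarith
    also have "\<bar>?d * (g x \<bullet> \<theta>) * (z - x \<bullet> \<theta>)\<bar> \<le> ?d * L * (\<rho> / 2)"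
      unfolding abs_mult using z gx[OF \<theta>, of x] L_pos by (intro mult_mono) auto
    finally show "\<bar>- (V x / p) - ?d * (g x \<bullet> \<theta>) * (z - x \<bullet> \<theta>)\<bar> \<le> \<bar>V x\<bar> / p + ?d * L * (\<rho> / 2)"
      using p by simp
  qed
  have V_le_M: "\<bar>V x\<bar> / p \<le> M" if "x \<in> X" for x
  proof -
    have "\<bar>V x\<bar> / p + ?d * L * (\<rho> / 2) \<le> M"
      unfolding M_def using X(1) that M_nn by (intro member_le_sum) auto
    moreover have "0 \<le> ?d * L * (\<rho> / 2)" using \<rho> L_pos by simp
    ultimately show ?thesis by linarith
  qed
  obtain x0 where x0: "x0 \<in> X" using X by blast
  have M0: "0 \<le> M" using V_le_M[OF x0] p by (auto intro: order_trans[rotated])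
  \<comment> \<open>Outside the cell of \<open>x\<close> the gap is at least
    \<open>\<rho> / 2\<close>, where \<open>8 * M / \<rho>\<^sup>2\<close> times its square is at
    least \<open>2 * M\<close>, a bound for the sum of both potentials. The summand 1 makes
    \<open>C\<close> positive even if \<open>M = 0\<close>.\<close>
  define C where "C = 8 * M / \<rho>\<^sup>2 + 1"
  have C: "0 < C" using M0 \<rho> by (simp add: C_def add_nonneg_pos)
  define f where "f \<theta> y = indicator \<Theta> \<theta> * u \<theta> (y \<bullet> \<theta>)" for \<theta> y
  \<comment> \<open>On \<open>\<Theta>\<close> and at the atoms this agrees with
    \<open>b l \<theta> (x \<bullet> \<theta>)\<close>, but being free of cells it can be averaged
    over \<open>\<theta>\<close> explicitly.\<close>
  define h where "h l \<theta> x = indicator \<Theta> \<theta> * (V x / p - (?d * (g x \<bullet> \<theta>))\<^sup>2 / (2 * l))" for l \<theta> x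
  define U where "U y = (\<integral>\<theta>. f \<theta> y \<partial>sphere_unif)" for y
  have f_meas[measurable]: "case_prod f \<in> borel_measurable (borel \<Otimes>\<^sub>M borel)"
    unfolding f_def by measurable
  have h_meas[measurable]: "case_prod (h l) \<in> borel_measurable (borel \<Otimes>\<^sub>M borel)" for l
    unfolding h_def by measurable
  have f_le: "\<bar>f \<theta> y\<bar> \<le> M * (norm \<theta>)\<^sup>2" for \<theta> y
    using u_le[OF norm\<Theta>] norm\<Theta> M0 by (cases "\<theta> \<in> \<Theta>") (auto simp: f_def)
  have h_le: "\<bar>h l \<theta> x\<bar> \<le> (\<bar>V x\<bar> / p + (?d * L)\<^sup>2 / (2 * l)) * (norm \<theta>)\<^sup>2" if l: "0 < l" for l \<theta> x
  proof (cases "\<theta> \<in> \<Theta>")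
    case True
    have "\<bar>V x / p - (?d * (g x \<bullet> \<theta>))\<^sup>2 / (2 * l)\<bar> \<le> \<bar>V x\<bar> / p + (?d * (g x \<bullet> \<theta>))\<^sup>2 / (2 * l)"
      using p l by (intro order_trans[OF abs_triangle_ineq4]) simp
    also have "(?d * (g x \<bullet> \<theta>))\<^sup>2 \<le> (?d * L)\<^sup>2"
      using gx[OF norm\<Theta>[OF True], of x] by (intro abs_le_square_iff[THEN iffD1]) (auto simp: abs_mult)
    finally show ?thesis using True norm\<Theta>[OF True] l by (simp add: h_def divide_right_mono)
  qed (use p l in \<open>simp add: h_def add_nonneg_nonneg\<close>)
  have f_int: "integrable sphere_unif (\<lambda>\<theta>. f \<theta> y)" for y
  proof (rule Bochner_Integration.integrable_bound)
    show "integrable sphere_unif (\<lambda>\<theta>::'a. M * (norm \<theta>)\<^sup>2)"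
      by (intro integrable_mult_right integrable_sphere_unif_norm)
  qed (use f_le in \<open>auto intro!: AE_I2 order_trans[OF _ abs_ge_self]\<close>)

  have dual: "b l \<theta> (x \<bullet> \<theta>) + u \<theta> z \<le> (l / 2 + C) * (x \<bullet> \<theta> - z)\<^sup>2"
    if \<theta>: "\<theta> \<in> \<Theta>" and x: "x \<in> X" and l: "0 < l" for l \<theta> x z
  proof -
    have b_eq: "b l \<theta> (x \<bullet> \<theta>) = V x / p - (?d * (g x \<bullet> \<theta>))\<^sup>2 / (2 * l)"
      unfolding b_def using cell_sum_eq[OF X(1) sep[OF \<theta>] x, of "x \<bullet> \<theta>"] \<rho> by simp
    show ?thesis
    proof (cases "\<bar>z - x \<bullet> \<theta>\<bar> < \<rho> / 2")
      case True
      have "u \<theta> z = - (V x / p) - ?d * (g x \<bullet> \<theta>) * (z - x \<bullet> \<theta>)"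
        unfolding u_def using cell_sum_eq[OF X(1) sep[OF \<theta>] x True] .
      then have "b l \<theta> (x \<bullet> \<theta>) + u \<theta> z = ?d * (g x \<bullet> \<theta>) * (x \<bullet> \<theta> - z) - (?d * (g x \<bullet> \<theta>))\<^sup>2 / (2 * l)"
        using b_eq by (simp add: algebra_simps)
      also have "\<dots> \<le> l / 2 * (x \<bullet> \<theta> - z)\<^sup>2"
        using young_mult[OF l, of "?d * (g x \<bullet> \<theta>)" "x \<bullet> \<theta> - z"] by linarith
      also have "\<dots> \<le> (l / 2 + C) * (x \<bullet> \<theta> - z)\<^sup>2" using C by (intro mult_right_mono) auto
      finally show ?thesis .
    next
      \<comment> \<open>This covers \<open>z\<close> in the cell of another atom as well as
        \<open>z\<close> outside all cells; only the size of the potentials is used.\<close>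
      case False
      have "(\<rho> / 2)\<^sup>2 \<le> (x \<bullet> \<theta> - z)\<^sup>2"
        using False \<rho> by (intro abs_le_square_iff[THEN iffD1]) (auto simp: abs_minus_commute)
      then have "8 * M / \<rho>\<^sup>2 * (\<rho> / 2)\<^sup>2 \<le> 8 * M / \<rho>\<^sup>2 * (x \<bullet> \<theta> - z)\<^sup>2"
        using M0 by (intro mult_left_mono) auto
      then have "2 * M \<le> 8 * M / \<rho>\<^sup>2 * (x \<bullet> \<theta> - z)\<^sup>2"
        using \<rho> by (simp add: power_divide)
      also have "\<dots> \<le> (l / 2 + C) * (x \<bullet> \<theta> - z)\<^sup>2"
        using l by (intro mult_right_mono) (auto simp: C_def)
      finally have "2 * M \<le> (l / 2 + C) * (x \<bullet> \<theta> - z)\<^sup>2" .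
      moreover have "b l \<theta> (x \<bullet> \<theta>) \<le> M"
      proof -
        have "V x / p \<le> \<bar>V x\<bar> / p" using p by (simp add: divide_right_mono)
        moreover have "0 \<le> (?d * (g x \<bullet> \<theta>))\<^sup>2 / (2 * l)" using l by simp
        ultimately show ?thesis using b_eq V_le_M[OF x] by linarith
      qed
      moreover have "u \<theta> z \<le> M" using u_le[OF norm\<Theta>[OF \<theta>], of z] by linarith
      ultimately show ?thesis by linarith
    qed
  qed


  obtain R where R: "\<And>x. x \<in> X \<Longrightarrow> norm x \<le> R"
    using finite_imp_bounded[OF X(1)] by (auto simp: bounded_iff)
  obtain \<delta> where \<delta>: "0 < \<delta>" "\<And>x y. norm x \<le> R \<Longrightarrow> norm (y - x) < \<delta> \<Longrightarrow>
      \<bar>V y - V x - (y - x) \<bullet> g x\<bar> \<le> \<epsilon> / 2 * norm (y - x)"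
    using uniform_taylor[of "\<epsilon> / 2" R] \<epsilon> by auto
  \<comment> \<open>Below \<open>r\<close> the Taylor estimate holds, and on every line with
    \<open>\<theta> \<in> \<Theta>\<close> the projection of \<open>y\<close> remains in the cell of
    its nearest atom.\<close>
  define r where "r = min \<delta> (\<rho> / 2)"
  have r: "0 < r" "r \<le> \<delta>" "r \<le> \<rho> / 2" using \<delta> \<rho> by (auto simp: r_def)
  \<comment> \<open>At distance at least \<open>r\<close> the crude bound
    \<open>2 * M + L * norm (y - x)\<close> is quadratic in the distance with this constant.\<close>
  define K where "K = 2 * M / r\<^sup>2 + L / r"
  have K: "0 < K" using M0 r L_pos by (simp add: K_def add_nonneg_pos)

  show ?thesis
  proof (rule that[of C K U])
    show "0 < C" "0 < K" by fact+
  next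
    fix \<nu> :: "'a measure" assume \<nu>: "\<nu> \<in> P2"
    interpret prob_space \<nu> using \<nu> P2D by auto
    show "integrable \<nu> U"
      unfolding U_def
      by (rule sphere_unif_integrable_snd[OF prob_space_axioms P2D(2)[OF \<nu>] f_meas _ f_le]) simp
  next
    fix \<nu> :: "'a measure" and l :: real assume \<nu>: "\<nu> \<in> P2" and l: "0 < l"
    interpret \<mu>: prob_space \<mu> using \<mu> P2D by auto
    interpret \<nu>: prob_space \<nu> using \<nu> P2D by auto
    note s = P2D(2)[OF \<mu>] P2D(2)[OF \<nu>]
    note [measurable_cong] = s
    have wi: "integrable \<nu> (\<lambda>_. M)" "integrable \<mu> (\<lambda>x. \<bar>V x\<bar> / p + (?d * L)\<^sup>2 / (2 * l))"
      using integrable_V[OF \<mu>] by auto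
    note Ff = \<nu>.prob_space_axioms s(2) f_meas wi(1) f_le
    note Fh = \<mu>.prob_space_axioms s(1) h_meas wi(2) h_le[OF l]
    have line: "(\<integral>x. h l \<theta> x \<partial>\<mu>) + (\<integral>y. f \<theta> y \<partial>\<nu>) \<le> (l / 2 + C) * (W (proj \<theta> \<mu>) (proj \<theta> \<nu>))\<^sup>2" for \<theta>
    proof (cases "\<theta> \<in> \<Theta>")
      case True
      have mb: "b l \<theta> \<in> borel_measurable borel" and mu: "u \<theta> \<in> borel_measurable borel"
        by measurable
      have hb: "AE x in \<mu>. h l \<theta> x = b l \<theta> (x \<bullet> \<theta>)"
        using X(3)
      proof eventually_elim
        case (elim x)
        then show ?case
          unfolding b_def h_def using cell_sum_eq[OF X(1) sep[OF True] elim, of "x \<bullet> \<theta>"] \<rho> True by simp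
      qed
      have fu: "f \<theta> = (\<lambda>y. u \<theta> (y \<bullet> \<theta>))" using True by (simp add: f_def fun_eq_iff)
      have ih: "integrable \<mu> (h l \<theta>)" by (rule sphere_unif_integrable_inner[OF Fh])
      have if': "integrable \<nu> (f \<theta>)" by (rule sphere_unif_integrable_inner[OF Ff])
      have "integral\<^sup>L (proj \<theta> \<mu>) (b l \<theta>) + integral\<^sup>L (proj \<theta> \<nu>) (u \<theta>) \<le> (l / 2 + C) * (W (proj \<theta> \<mu>) (proj \<theta> \<nu>))\<^sup>2"
      proof (rule W_dual[OF proj_P2[OF \<mu>] proj_P2[OF \<nu>]])
        have "integrable \<mu> (\<lambda>x. b l \<theta> (x \<bullet> \<theta>))"
          using ih hb mb by (subst integrable_cong_AE[where g = "h l \<theta>"]) (auto elim!: eventually_mono)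
        then show "integrable (proj \<theta> \<mu>) (b l \<theta>)" by (simp add: integral_proj(2)[OF s(1) mb])
        show "integrable (proj \<theta> \<nu>) (u \<theta>)" using if' by (simp add: integral_proj(2)[OF s(2) mu] fu)
        show "0 < l / 2 + C" using l C by simp
        show "AE z in proj \<theta> \<mu>. \<forall>z'. b l \<theta> z + u \<theta> z' \<le> (l / 2 + C) * (dist z z')\<^sup>2"
          using AE_proj_finite[OF s(1) X(1,3), of \<theta>]
          by eventually_elim (use dual[OF True _ l] in \<open>auto simp: dist_real_def\<close>)
      qed
      also have "integral\<^sup>L (proj \<theta> \<mu>) (b l \<theta>) = (\<integral>x. h l \<theta> x \<partial>\<mu>)"
        using hb mb by (simp add: integral_proj(1)[OF s(1) mb]) (intro integral_cong_AE, auto elim!: eventually_mono)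
      also have "integral\<^sup>L (proj \<theta> \<nu>) (u \<theta>) = (\<integral>y. f \<theta> y \<partial>\<nu>)"
        by (simp add: integral_proj(1)[OF s(2) mu] fu)
      finally show ?thesis .
    qed (use l C in \<open>simp add: h_def f_def\<close>)
    have "(\<integral>\<theta>. (\<integral>x. h l \<theta> x \<partial>\<mu>) + (\<integral>y. f \<theta> y \<partial>\<nu>) \<partial>sphere_unif) \<le> (l / 2 + C) * (SW \<mu> \<nu>)\<^sup>2"
      using sphere_unif_integrable_fst[OF Fh] sphere_unif_integrable_fst[OF Ff] l C line
      by (intro integral_le_SW \<mu> \<nu>) auto
    also have "(\<integral>\<theta>. (\<integral>x. h l \<theta> x \<partial>\<mu>) + (\<integral>y. f \<theta> y \<partial>\<nu>) \<partial>sphere_unif)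
        = (\<integral>x. (\<integral>\<theta>. h l \<theta> x \<partial>sphere_unif) \<partial>\<mu>) + (\<integral>y. U y \<partial>\<nu>)"
      using sphere_unif_integrable_fst[OF Fh] sphere_unif_integrable_fst[OF Ff]
      by (simp add: sphere_unif_Fubini[OF Fh] sphere_unif_Fubini[OF Ff] U_def)
    finally have 1: "(\<integral>x. (\<integral>\<theta>. h l \<theta> x \<partial>sphere_unif) \<partial>\<mu>) + (\<integral>y. U y \<partial>\<nu>) \<le> (l / 2 + C) * (SW \<mu> \<nu>)\<^sup>2" .
    \<comment> \<open>The quadratic term is enlarged from \<open>\<Theta>\<close> to the whole
      sphere, which only lowers the value; there
      \<open>(?d * (g x \<bullet> \<theta>))\<^sup>2\<close> averages to
      \<open>?d * (norm (g x))\<^sup>2\<close>.\<close>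
    have 2: "V x - ?d * (norm (g x))\<^sup>2 / (2 * l) \<le> (\<integral>\<theta>. h l \<theta> x \<partial>sphere_unif)" for x
    proof -
      have i1: "integrable sphere_unif (\<lambda>\<theta>. indicator \<Theta> \<theta> * (V x / p))"
        by (intro integrable_mult_left) (auto simp: S.emeasure_eq_measure)
      have i2: "integrable sphere_unif (\<lambda>\<theta>. ?d\<^sup>2 / (2 * l) * ((\<theta> \<bullet> g x) * (\<theta> \<bullet> g x)))"
        by (intro integrable_mult_right integrable_sphere_unif_inner)
      have "(\<integral>\<theta>. indicator \<Theta> \<theta> * (V x / p) \<partial>sphere_unif) = V x"
        using p by (simp add: p_def)
      moreover have "(\<integral>\<theta>. ?d\<^sup>2 / (2 * l) * ((\<theta> \<bullet> g x) * (\<theta> \<bullet> g x)) \<partial>sphere_unif) = ?d * (norm (g x))\<^sup>2 / (2 * l)"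
        by (simp add: sphere_unif_inner_inner dot_square_norm power2_eq_square[of ?d])
      ultimately have "V x - ?d * (norm (g x))\<^sup>2 / (2 * l)
          = (\<integral>\<theta>. indicator \<Theta> \<theta> * (V x / p) - ?d\<^sup>2 / (2 * l) * ((\<theta> \<bullet> g x) * (\<theta> \<bullet> g x)) \<partial>sphere_unif)"
        by (simp only: Bochner_Integration.integral_diff[OF i1 i2])
      also have "\<dots> \<le> (\<integral>\<theta>. h l \<theta> x \<partial>sphere_unif)"
      proof (rule integral_mono)
        show "integrable sphere_unif (\<lambda>\<theta>. h l \<theta> x)"
        proof (rule Bochner_Integration.integrable_bound)
          show "integrable sphere_unif (\<lambda>\<theta>::'a. (\<bar>V x\<bar> / p + (?d * L)\<^sup>2 / (2 * l)) * (norm \<theta>)\<^sup>2)"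
            by (intro integrable_mult_right integrable_sphere_unif_norm)
        qed (use h_le[OF l] in \<open>auto intro!: AE_I2 order_trans[OF _ abs_ge_self]\<close>)
        show "indicator \<Theta> \<theta> * (V x / p) - ?d\<^sup>2 / (2 * l) * ((\<theta> \<bullet> g x) * (\<theta> \<bullet> g x)) \<le> h l \<theta> x" for \<theta>
          using l by (cases "\<theta> \<in> \<Theta>")
            (auto simp: h_def power2_eq_square inner_commute mult_ac)
      qed (use i1 i2 in auto)
      finally show ?thesis .
    qed
    have "potential_energy V \<mu> - ?d * (gradient_norm g \<mu>)\<^sup>2 / (2 * l)
        = (\<integral>x. V x - ?d * (norm (g x))\<^sup>2 / (2 * l) \<partial>\<mu>)"
      using integrable_V[OF \<mu>] integrable_g[OF \<mu>.prob_space_axioms s(1)]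
      by (simp add: potential_energy_def gradient_norm_squared)
    also have "\<dots> \<le> (\<integral>x. (\<integral>\<theta>. h l \<theta> x \<partial>sphere_unif) \<partial>\<mu>)"
      using integrable_V[OF \<mu>] integrable_g[OF \<mu>.prob_space_axioms s(1)] 2 sphere_unif_integrable_snd[OF Fh]
      by (intro integral_mono) auto
    finally show "potential_energy V \<mu> + (\<integral>y. U y \<partial>\<nu>)
        \<le> ?d * (gradient_norm g \<mu>)\<^sup>2 / (2 * l) + (l / 2 + C) * (SW \<mu> \<nu>)\<^sup>2"
      using 1 by linarith
  next
    fix y :: 'a
    obtain x where x: "x \<in> X" "infdist y X = dist y x"
      using infdist_attains_inf[OF finite_imp_closed[OF X(1)] X(2)] by blast
    have m: "infdist y X = norm (y - x)" using x by (simp add: dist_norm)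
    show "\<bar>V y + U y\<bar> \<le> \<epsilon> * infdist y X + K * (infdist y X)\<^sup>2"
    proof (cases "norm (y - x) < r")
      case True
      let ?q = "\<lambda>\<theta>. (\<theta> \<bullet> g x) * (\<theta> \<bullet> (y - x))"
      \<comment> \<open>The linear part over \<open>\<Theta>\<close> is written as its value over
        the whole sphere, whose mean is exactly \<open>(y - x) \<bullet> g x\<close>, corrected by
        the part over the few directions outside \<open>\<Theta>\<close>.\<close>
      have near: "f \<theta> y = indicator \<Theta> \<theta> * (- (V x / p)) - ?d * ?q \<theta> + indicator (- \<Theta>) \<theta> * (?d * ?q \<theta>)" for \<theta>
      proof (cases "\<theta> \<in> \<Theta>")
        case \<theta>: True
        have "\<bar>y \<bullet> \<theta> - x \<bullet> \<theta>\<bar> \<le> norm (y - x)"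
          using Cauchy_Schwarz_ineq2[of "y - x" \<theta>] norm\<Theta>[OF \<theta>] by (simp add: inner_diff_left)
        then have "\<bar>y \<bullet> \<theta> - x \<bullet> \<theta>\<bar> < \<rho> / 2" using True r by linarith
        then have "u \<theta> (y \<bullet> \<theta>) = - (V x / p) - ?d * (g x \<bullet> \<theta>) * (y \<bullet> \<theta> - x \<bullet> \<theta>)"
          unfolding u_def by (rule cell_sum_eq[OF X(1) sep[OF \<theta>] x(1)])
        then show ?thesis using \<theta> by (simp add: f_def inner_diff_right inner_commute)
      qed (simp add: f_def)
      have i1: "integrable sphere_unif (\<lambda>\<theta>. indicator \<Theta> \<theta> * (- (V x / p)))"
        by (intro integrable_mult_left) (auto simp: S.emeasure_eq_measure)
      have i2: "integrable sphere_unif (\<lambda>\<theta>. ?d * ?q \<theta>)"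
        by (intro integrable_mult_right integrable_sphere_unif_inner)
      have i3: "integrable sphere_unif (\<lambda>\<theta>. indicator (- \<Theta>) \<theta> * (?d * ?q \<theta>))"
        using integrable_mult_indicator[OF _ i2, of "- \<Theta>"] \<Theta> by auto
      have "U y = (\<integral>\<theta>. indicator \<Theta> \<theta> * (- (V x / p)) \<partial>sphere_unif) - (\<integral>\<theta>. ?d * ?q \<theta> \<partial>sphere_unif)
          + (\<integral>\<theta>. indicator (- \<Theta>) \<theta> * (?d * ?q \<theta>) \<partial>sphere_unif)"
        unfolding U_def near using i1 i2 i3 by simp
      also have "(\<integral>\<theta>. indicator \<Theta> \<theta> * (- (V x / p)) \<partial>sphere_unif) = - V x"
        using p by (simp add: p_def)
      also have "(\<integral>\<theta>. ?d * ?q \<theta> \<partial>sphere_unif) = (y - x) \<bullet> g x"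
        by (simp add: sphere_unif_inner_inner inner_commute)
      finally have Uy: "V y + U y = (V y - V x - (y - x) \<bullet> g x) + (\<integral>\<theta>. indicator (- \<Theta>) \<theta> * (?d * ?q \<theta>) \<partial>sphere_unif)"
        by simp
      have "\<bar>\<integral>\<theta>. indicator (- \<Theta>) \<theta> * (?d * ?q \<theta>) \<partial>sphere_unif\<bar>
          \<le> (\<integral>\<theta>. \<bar>indicator (- \<Theta>) \<theta> * (?d * ?q \<theta>)\<bar> \<partial>sphere_unif)"
        by (rule integral_abs_bound)
      also have "\<dots> \<le> (\<integral>\<theta>. indicator (- \<Theta>) \<theta> * (?d * (L * norm (y - x))) \<partial>sphere_unif)"
      proof (rule integral_mono_AE)
        show "integrable sphere_unif (\<lambda>\<theta>. \<bar>indicator (- \<Theta>) \<theta> * (?d * ?q \<theta>)\<bar>)" using i3 by (rule integrable_abs)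
        show "integrable sphere_unif (\<lambda>\<theta>. indicator (- \<Theta>) \<theta> * (?d * (L * norm (y - x))))"
          using \<Theta> by (intro integrable_mult_left) (auto simp: S.emeasure_eq_measure)
        show "AE \<theta> in sphere_unif. \<bar>indicator (- \<Theta>) \<theta> * (?d * ?q \<theta>)\<bar> \<le> indicator (- \<Theta>) \<theta> * (?d * (L * norm (y - x)))"
          using AE_sphere_unif_norm
        proof eventually_elim
          case (elim \<theta>)
          have "\<bar>?q \<theta>\<bar> \<le> L * norm (y - x)"
            unfolding abs_mult using gx[OF elim, of x] Cauchy_Schwarz_ineq2[of \<theta> "y - x"] elim L_pos
            by (intro mult_mono) (auto simp: inner_commute)
          then show ?case by (auto simp: abs_mult indicator_def)
        qed
      qed
      also have "\<dots> = measure sphere_unif (- \<Theta>) * (?d * (L * norm (y - x)))"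
        using \<Theta> by simp
      also have "\<dots> \<le> \<eta> * (?d * (L * norm (y - x)))"
        using S.prob_compl[of \<Theta>] p L_pos by (intro mult_right_mono) (auto simp: p_def Compl_eq_Diff_UNIV)
      also have "\<dots> = (?d * L * \<eta>) * norm (y - x)" by simp
      also have "\<dots> \<le> \<epsilon> / 2 * norm (y - x)" using \<eta>(3) by (intro mult_right_mono) auto
      finally have bad: "\<bar>\<integral>\<theta>. indicator (- \<Theta>) \<theta> * (?d * ?q \<theta>) \<partial>sphere_unif\<bar> \<le> \<epsilon> / 2 * norm (y - x)" .
      have "\<bar>V y - V x - (y - x) \<bullet> g x\<bar> \<le> \<epsilon> / 2 * norm (y - x)"
        using True r by (intro \<delta>(2)[OF R[OF x(1)]]) simp
      with bad have "\<bar>V y + U y\<bar> \<le> \<epsilon> * norm (y - x)"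
        unfolding Uy by linarith
      moreover have "0 \<le> K * (infdist y X)\<^sup>2" using K by simp
      ultimately show ?thesis by (simp add: m)
    next
      case False
      have "\<bar>U y\<bar> \<le> (\<integral>\<theta>. \<bar>f \<theta> y\<bar> \<partial>sphere_unif)" unfolding U_def by (rule integral_abs_bound)
      also have "\<dots> \<le> (\<integral>\<theta>. M \<partial>(sphere_unif :: 'a measure))"
      proof (rule integral_mono_AE)
        show "AE \<theta> in sphere_unif. \<bar>f \<theta> y\<bar> \<le> M"
          using AE_sphere_unif_norm
        proof eventually_elim
          case (elim \<theta>)
          then show ?case using f_le[of \<theta> y] by simp
        qed
      qed (use f_int in auto)
      also have "\<dots> = M" using S.prob_space by simp
      finally have U_le: "\<bar>U y\<bar> \<le> M" .
      have "\<bar>V x\<bar> \<le> \<bar>V x\<bar> / p" using p by (simp add: pos_le_divide_eq mult_left_le)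
      then have "\<bar>V y + U y\<bar> \<le> 2 * M + L * norm (y - x)"
        using U_le V_le_M[OF x(1)] lipschitz[of y x] by linarith
      moreover have "2 * M \<le> 2 * M / r\<^sup>2 * (norm (y - x))\<^sup>2"
      proof -
        have "2 * M / r\<^sup>2 * r\<^sup>2 \<le> 2 * M / r\<^sup>2 * (norm (y - x))\<^sup>2"
          using False M0 r by (intro mult_left_mono power_mono) auto
        then show ?thesis using r by simp
      qed
      moreover have "L * norm (y - x) \<le> L / r * (norm (y - x))\<^sup>2"
      proof -
        have "L / r * norm (y - x) * r \<le> L / r * norm (y - x) * norm (y - x)"
          using False L_pos r by (intro mult_left_mono) auto
        then show ?thesis using r by (simp add: power2_eq_square)
      qed
      moreover have "0 \<le> \<epsilon> * norm (y - x)" using \<epsilon> by simp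
      ultimately show ?thesis unfolding m K_def by (simp add: distrib_right)
    qed
  qed
qed

text \<open>The energy difference is \<open>potential_energy V \<mu> + (\<integral>y. U y
  \<partial>\<nu>)\<close> minus the \<open>\<nu>\<close>-integral of \<open>V + U\<close>. Duality
  with optimised weight bounds the former; the latter is an error away from the atoms, controlled by
  the first two moments of \<open>infdist\<close>.\<close>

lemma SW_slope_le_of_finite_support:
  assumes \<mu>: "\<mu> \<in> P2" and X: "finite X" "AE x in \<mu>. x \<in> X"
  shows "metric_slope P2 SW (potential_energy V) \<mu> \<le> ennreal (sqrt DIM('a) * gradient_norm g \<mu>)"
proof (rule metric_slope_le)
  interpret \<mu>: prob_space \<mu> using \<mu> P2D by auto
  have X': "X \<noteq> {}" using X(2) \<mu>.AE_False by auto
  let ?c = "sqrt DIM('a) * gradient_norm g \<mu>"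
  show "0 \<le> ?c" by simp
  show "0 \<le> SW \<mu> \<nu>" for \<nu> by simp
  fix \<epsilon> :: real assume \<epsilon>: "0 < \<epsilon>"
  obtain C1 where C1: "0 < C1" "\<And>\<nu>. \<nu> \<in> P2 \<Longrightarrow> integrable \<nu> (\<lambda>y. (infdist y X)\<^sup>2)"
    "\<And>\<nu>. \<nu> \<in> P2 \<Longrightarrow> (\<integral>y. (infdist y X)\<^sup>2 \<partial>\<nu>) \<le> C1 * (SW \<mu> \<nu>)\<^sup>2"
    using infdist_second_moment_le_SW[OF \<mu> X(1) X' X(2)] by metis
  \<comment> \<open>The first moment of \<open>infdist\<close> will be at most
    \<open>sqrt C1 * SW \<mu> \<nu>\<close>, so its contribution becomes
    \<open>\<epsilon> / 4\<close> times the distance.\<close>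
  define \<epsilon>' where "\<epsilon>' = \<epsilon> / (4 * sqrt C1)"
  have \<epsilon>': "0 < \<epsilon>'" "\<epsilon>' * sqrt C1 = \<epsilon> / 4" using \<epsilon> C1(1) by (simp_all add: \<epsilon>'_def)
  obtain U C K where C: "0 < C" and K: "0 < K" and iU: "\<And>\<nu>. \<nu> \<in> P2 \<Longrightarrow> integrable \<nu> U"
    and young: "\<And>\<nu> l. \<nu> \<in> P2 \<Longrightarrow> 0 < l \<Longrightarrow> potential_energy V \<mu> + (\<integral>y. U y \<partial>\<nu>)
      \<le> DIM('a) * (gradient_norm g \<mu>)\<^sup>2 / (2 * l) + (l / 2 + C) * (SW \<mu> \<nu>)\<^sup>2"
    and VU: "\<And>y. \<bar>V y + U y\<bar> \<le> \<epsilon>' * infdist y X + K * (infdist y X)\<^sup>2"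
    using sliced_competitor[OF \<mu> X(1) X' X(2) \<epsilon>'(1)] by metis
  \<comment> \<open>The margin \<open>\<epsilon> / 4\<close> ensures \<open>0 < A\<close> also when
    the gradient norm is 0.\<close>
  define A where "A = ?c + \<epsilon> / 4"
  have A: "0 < A" using \<epsilon> by (simp add: A_def add_nonneg_pos)
  have A2: "DIM('a) * (gradient_norm g \<mu>)\<^sup>2 \<le> A\<^sup>2"
  proof -
    have "?c\<^sup>2 \<le> A\<^sup>2" using \<epsilon> by (intro power_mono) (auto simp: A_def)
    then show ?thesis by (simp add: power_mult_distrib)
  qed
  let ?K = "C + K * C1"
  have K': "0 < ?K" using C K C1(1) by (simp add: add_pos_pos)
  show "\<exists>e>0. \<forall>\<nu>\<in>P2. 0 < SW \<mu> \<nu> \<longrightarrow> SW \<mu> \<nu> < e \<longrightarrow>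
      potential_energy V \<mu> - potential_energy V \<nu> \<le> (?c + \<epsilon>) * SW \<mu> \<nu>"
  proof (intro exI conjI ballI impI)
    \<comment> \<open>Both quadratic terms together then cost at most \<open>\<epsilon> / 2\<close>
      times the distance, completing the two quarters already spent.\<close>
    show "0 < \<epsilon> / (2 * ?K)" using \<epsilon> K' by simp
    fix \<nu> :: "'a measure" assume \<nu>: "\<nu> \<in> P2" and w: "0 < SW \<mu> \<nu>" "SW \<mu> \<nu> < \<epsilon> / (2 * ?K)"
    interpret \<nu>: prob_space \<nu> using \<nu> P2D by auto
    have s[measurable_cong]: "sets \<nu> = sets borel" using \<nu> P2D by auto
    have [measurable]: "(\<lambda>y. infdist y X) \<in> borel_measurable borel"
      by (intro borel_measurable_continuous_onI continuous_on_infdist continuous_on_id)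
    let ?w = "SW \<mu> \<nu>"
    have 1: "potential_energy V \<mu> + (\<integral>y. U y \<partial>\<nu>) \<le> A * ?w + C * ?w\<^sup>2"
    proof (rule le_of_young[OF A w(1)])
      fix l :: real assume l: "0 < l"
      have "DIM('a) * (gradient_norm g \<mu>)\<^sup>2 / (2 * l) \<le> A\<^sup>2 / (2 * l)"
        using A2 l by (intro divide_right_mono) auto
      then show "potential_energy V \<mu> + (\<integral>y. U y \<partial>\<nu>) \<le> A\<^sup>2 / (2 * l) + (l / 2 + C) * ?w\<^sup>2"
        using young[OF \<nu> l] by linarith
    qed
    have im: "integrable \<nu> (\<lambda>y. infdist y X)"
      using \<nu>.square_integrable_imp_integrable[OF _ C1(2)[OF \<nu>]] by simp
    \<comment> \<open>Non-negativity of the variance serves as Cauchy-Schwarz against the constant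
      1.\<close>
    have "(\<integral>y. infdist y X \<partial>\<nu>)\<^sup>2 \<le> (\<integral>y. (infdist y X)\<^sup>2 \<partial>\<nu>)"
      using \<nu>.variance_positive[of "\<lambda>y. infdist y X"] \<nu>.variance_eq[OF im C1(2)[OF \<nu>]] by simp
    also have "\<dots> \<le> (sqrt C1 * ?w)\<^sup>2"
      using C1(3)[OF \<nu>] C1(1) by (simp add: power_mult_distrib)
    finally have m: "(\<integral>y. infdist y X \<partial>\<nu>) \<le> sqrt C1 * ?w"
      using C1(1) by (auto intro: power2_le_imp_le)
    have "- (\<integral>y. V y + U y \<partial>\<nu>) = (\<integral>y. - (V y + U y) \<partial>\<nu>)" by (rule integral_minus[symmetric])
    also have "\<dots> \<le> (\<integral>y. \<epsilon>' * infdist y X + K * (infdist y X)\<^sup>2 \<partial>\<nu>)"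
    proof (rule integral_mono)
      show "- (V y + U y) \<le> \<epsilon>' * infdist y X + K * (infdist y X)\<^sup>2" for y
        using VU[of y] by linarith
    qed (use iU[OF \<nu>] integrable_V[OF \<nu>] im C1(2)[OF \<nu>] in auto)
    also have "\<dots> = \<epsilon>' * (\<integral>y. infdist y X \<partial>\<nu>) + K * (\<integral>y. (infdist y X)\<^sup>2 \<partial>\<nu>)"
      using im C1(2)[OF \<nu>] by simp
    also have "\<dots> \<le> \<epsilon>' * (sqrt C1 * ?w) + K * (C1 * ?w\<^sup>2)"
      using m C1(3)[OF \<nu>] \<epsilon>'(1) K by (intro add_mono mult_left_mono) auto
    also have "\<dots> = \<epsilon> / 4 * ?w + K * C1 * ?w\<^sup>2" using \<epsilon>'(2) by simp
    finally have 2: "- (\<integral>y. V y + U y \<partial>\<nu>) \<le> \<epsilon> / 4 * ?w + K * C1 * ?w\<^sup>2" .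
    have "?K * ?w\<^sup>2 \<le> \<epsilon> / 2 * ?w"
    proof -
      have "?K * ?w \<le> \<epsilon> / 2" using w(2) K' by (simp add: pos_less_divide_eq algebra_simps)
      then have "?K * ?w * ?w \<le> \<epsilon> / 2 * ?w" using w(1) by (intro mult_right_mono) auto
      then show ?thesis by (simp add: power2_eq_square mult.assoc)
    qed
    moreover have "(\<integral>y. V y + U y \<partial>\<nu>) = potential_energy V \<nu> + (\<integral>y. U y \<partial>\<nu>)"
      using iU[OF \<nu>] integrable_V[OF \<nu>] by (simp add: potential_energy_def)
    ultimately show "potential_energy V \<mu> - potential_energy V \<nu> \<le> (?c + \<epsilon>) * ?w"
      using 1 2 unfolding A_def by (simp add: algebra_simps)
  qed
qed

section \<open>Passage to the relaxed slope\<close>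

text \<open>Boundedness and continuity of the gradient make \<open>(norm (g x))\<^sup>2\<close>
  itself a test function for narrow convergence.\<close>

lemma gradient_norm_narrowly_conv:
  assumes "narrowly_conv \<mu>s \<mu>"
  shows "(\<lambda>k. gradient_norm g (\<mu>s k)) \<longlonglongrightarrow> gradient_norm g \<mu>"
proof -
  have "bounded (range (\<lambda>x. (norm (g x))\<^sup>2))"
    using norm_g_le L_pos by (auto intro!: boundedI[where B = "L\<^sup>2"] power_mono)
  moreover have "continuous_on UNIV (\<lambda>x. (norm (g x))\<^sup>2)" using cont_g by (intro continuous_intros)
  ultimately show ?thesis
    unfolding gradient_norm_def using assms by (intro tendsto_real_sqrt) (simp add: narrowly_conv_def)
qed

text \<open>Push \<open>\<mu>\<close> forward under simple functions converging pointwise to the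
  identity. Their bound by \<open>2 * norm x\<close> keeps second moments, and with them the
  distances to \<open>\<mu>\<close> and the energies, bounded, as admissibility in
  \<open>relaxed_slope\<close> demands; dominated convergence gives the narrow limit.\<close>

lemma finitely_supported_approximation:
  assumes \<mu>: "\<mu> \<in> P2"
  obtains \<mu>s where "\<And>k. \<mu>s k \<in> P2" "\<And>k. \<exists>X. finite X \<and> (AE x in \<mu>s k. x \<in> X)" "narrowly_conv \<mu>s \<mu>"
    "bdd_above (range (\<lambda>k. max (SW \<mu> (\<mu>s k)) (potential_energy V (\<mu>s k))))"
proof -
  interpret prob_space \<mu> using \<mu> P2D by auto
  have s[measurable_cong]: "sets \<mu> = sets borel" using \<mu> P2D by auto
  have "(\<lambda>x::'a. x) \<in> borel_measurable borel" by simp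
  from borel_measurable_implies_sequence_metric[OF this, of 0]
  obtain T where T: "\<And>i. simple_function borel (T i)" "\<And>x. (\<lambda>i. T i x) \<longlonglongrightarrow> x"
    "\<And>i x. dist (T i x) 0 \<le> 2 * dist x (0::'a)" by auto
  have [measurable]: "T i \<in> borel_measurable borel" for i using T(1) by (rule borel_measurable_simple_function)
  have nT: "norm (T i x) \<le> 2 * norm x" for i x using T(3)[of i x] by simp
  have nT2: "(norm (T i x))\<^sup>2 \<le> 4 * (norm x)\<^sup>2" for i x
    using power_mono[OF nT[of i x], of 2] by (simp add: power_mult_distrib)
  have iT: "integrable \<mu> (\<lambda>x. (norm (T i x))\<^sup>2)" for i
  proof (rule Bochner_Integration.integrable_bound)
    show "integrable \<mu> (\<lambda>x. 4 * (norm x)\<^sup>2)" using P2D(4)[OF \<mu>] by simp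
  qed (use nT2 in auto)
  let ?\<mu>s = "\<lambda>k. distr \<mu> borel (T k)"
  let ?M = "\<integral>x. (norm x)\<^sup>2 \<partial>\<mu>"
  have P2: "?\<mu>s k \<in> P2" for k using iT by (intro distr_P2[OF \<mu>]) auto
  have SW_bd: "SW \<mu> (?\<mu>s k) \<le> 9 * ?M + 1" for k
  proof -
    have dist2: "(dist x (T k x))\<^sup>2 \<le> 9 * (norm x)\<^sup>2" for x
    proof -
      have "dist x (T k x) \<le> 3 * norm x"
        unfolding dist_norm using norm_triangle_ineq4[of x "T k x"] nT[of k x] by linarith
      then show ?thesis using power_mono[of "dist x (T k x)" "3 * norm x" 2] by (simp add: power_mult_distrib)
    qed
    have "(SW \<mu> (?\<mu>s k))\<^sup>2 \<le> (W \<mu> (?\<mu>s k))\<^sup>2"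
    proof -
      have "1 * (SW \<mu> (?\<mu>s k))\<^sup>2 \<le> DIM('a) * (SW \<mu> (?\<mu>s k))\<^sup>2"
        by (intro mult_right_mono) (auto simp: Suc_leI)
      then show ?thesis using SW_squared_le_W_squared[OF \<mu> P2[of k]] by linarith
    qed
    also have "\<dots> \<le> (\<integral>x. (dist x (T k x))\<^sup>2 \<partial>\<mu>)" using iT by (intro W_distr_le[OF \<mu>]) auto
    also have "\<dots> \<le> (\<integral>x. 9 * (norm x)\<^sup>2 \<partial>\<mu>)"
    proof (rule integral_mono)
      show "integrable \<mu> (\<lambda>x. 9 * (norm x)\<^sup>2)" using P2D(4)[OF \<mu>] by simp
      then show "integrable \<mu> (\<lambda>x. (dist x (T k x))\<^sup>2)"
        by (rule Bochner_Integration.integrable_bound) (use dist2 in auto)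
    qed (rule dist2)
    finally have "(SW \<mu> (?\<mu>s k))\<^sup>2 \<le> 9 * ?M" by simp
    moreover have "2 * SW \<mu> (?\<mu>s k) \<le> (SW \<mu> (?\<mu>s k))\<^sup>2 + 1"
      using sum_squares_bound[of "SW \<mu> (?\<mu>s k)" 1] by simp
    moreover have "0 \<le> SW \<mu> (?\<mu>s k)" by simp
    ultimately show ?thesis by linarith
  qed
  have V_bd: "potential_energy V (?\<mu>s k) \<le> \<bar>V 0\<bar> + L * (1 + 4 * ?M)" for k
  proof -
    have "V (T k x) \<le> \<bar>V 0\<bar> + L * (1 + 4 * (norm x)\<^sup>2)" for x
    proof -
      have "norm (T k x) \<le> 1 + (norm (T k x))\<^sup>2"
        using sum_squares_bound[of 1 "norm (T k x)"] norm_ge_zero[of "T k x"] unfolding one_power2 by linarith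
      then have "norm (T k x) \<le> 1 + 4 * (norm x)\<^sup>2" using nT2[of k x] by linarith
      then have "L * norm (T k x) \<le> L * (1 + 4 * (norm x)\<^sup>2)" using L_pos by simp
      then show ?thesis using lipschitz[of "T k x" 0] by simp
    qed
    moreover have "integrable \<mu> (\<lambda>x. V (T k x))"
      using integrable_V[OF P2[of k]] by (simp add: integrable_distr_eq)
    ultimately have "(\<integral>x. V (T k x) \<partial>\<mu>) \<le> (\<integral>x. \<bar>V 0\<bar> + L * (1 + 4 * (norm x)\<^sup>2) \<partial>\<mu>)"
      using P2D(4)[OF \<mu>] by (intro integral_mono) auto
    also have "\<dots> = \<bar>V 0\<bar> + L * (1 + 4 * ?M)" using P2D(4)[OF \<mu>] by (simp add: prob_space)
    finally show ?thesis by (simp add: potential_energy_def integral_distr)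
  qed
  show ?thesis
  proof (rule that[of ?\<mu>s])
    show "?\<mu>s k \<in> P2" for k by (rule P2)
    show "\<exists>X. finite X \<and> (AE x in ?\<mu>s k. x \<in> X)" for k
    proof (intro exI conjI)
      show fin: "finite (range (T k))" using simple_functionD(1)[OF T(1)[of k]] by simp
      have "range (T k) \<in> sets borel" using fin by (simp add: finite_imp_closed)
      then show "AE x in ?\<mu>s k. x \<in> range (T k)" by (subst AE_distr_iff) auto
    qed
    show "narrowly_conv ?\<mu>s \<mu>"
      unfolding narrowly_conv_def
    proof (intro allI impI)
      fix f :: "'a \<Rightarrow> real" assume f: "continuous_on UNIV f \<and> bounded (range f)"
      then obtain B where B: "\<And>x. norm (f x) \<le> B" by (auto simp: bounded_iff)
      have [measurable]: "f \<in> borel_measurable borel" using f by (auto intro: borel_measurable_continuous_onI)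
      have "(\<lambda>k. \<integral>x. f (T k x) \<partial>\<mu>) \<longlonglongrightarrow> (\<integral>x. f x \<partial>\<mu>)"
      proof (rule integral_dominated_convergence[where w = "\<lambda>_. B"])
        show "AE x in \<mu>. (\<lambda>k. f (T k x)) \<longlonglongrightarrow> f x"
          using f T(2) by (intro AE_I2 continuous_on_tendsto_compose[of UNIV f]) auto
      qed (use B in auto)
      then show "(\<lambda>k. integral\<^sup>L (?\<mu>s k) f) \<longlonglongrightarrow> integral\<^sup>L \<mu> f"
        by (simp add: integral_distr)
    qed
    show "bdd_above (range (\<lambda>k. max (SW \<mu> (?\<mu>s k)) (potential_energy V (?\<mu>s k))))"
      using SW_bd V_bd
      by (intro bdd_aboveI2[where M = "max (9 * ?M + 1) (\<bar>V 0\<bar> + L * (1 + 4 * ?M))"] max.mono)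
  qed
qed

lemma relaxed_slope_eq:
  assumes \<mu>: "\<mu> \<in> P2"
  shows "relaxed_slope SW (potential_energy V) \<mu> = ennreal (sqrt DIM('a) * gradient_norm g \<mu>)"
proof -
  let ?c = "\<lambda>\<mu>. ennreal (sqrt DIM('a) * gradient_norm g \<mu>)"
  let ?s = "metric_slope P2 SW (potential_energy V)"
  have lim: "liminf (\<lambda>k. ?c (\<mu>s k)) = ?c \<mu>" if "narrowly_conv \<mu>s \<mu>" for \<mu>s
    using gradient_norm_narrowly_conv[OF that]
    by (intro lim_imp_Liminf tendsto_ennrealI tendsto_mult_left) auto
  show ?thesis
    unfolding relaxed_slope_def
  proof (rule antisym)
    obtain \<mu>s where \<mu>s: "\<And>k. \<mu>s k \<in> P2" "\<And>k. \<exists>X. finite X \<and> (AE x in \<mu>s k. x \<in> X)" "narrowly_conv \<mu>s \<mu>"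
      "bdd_above (range (\<lambda>k. max (SW \<mu> (\<mu>s k)) (potential_energy V (\<mu>s k))))"
      using finitely_supported_approximation[OF \<mu>] by metis
    have "liminf (\<lambda>k. ?s (\<mu>s k)) \<le> liminf (\<lambda>k. ?c (\<mu>s k))"
      using SW_slope_le_of_finite_support[OF \<mu>s(1)] \<mu>s(2)
      by (intro Liminf_mono always_eventually) blast
    also have "\<dots> = ?c \<mu>" by (rule lim[OF \<mu>s(3)])
    finally show "Inf {liminf (\<lambda>k. ?s (\<mu>s k)) | \<mu>s. (\<forall>k. \<mu>s k \<in> P2) \<and> narrowly_conv \<mu>s \<mu> \<and>
        bdd_above (range (\<lambda>k. max (SW \<mu> (\<mu>s k)) (potential_energy V (\<mu>s k))))} \<le> ?c \<mu>"
      using \<mu>s by (intro Inf_lower2) blast+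
  next
    show "?c \<mu> \<le> Inf {liminf (\<lambda>k. ?s (\<mu>s k)) | \<mu>s. (\<forall>k. \<mu>s k \<in> P2) \<and> narrowly_conv \<mu>s \<mu> \<and>
        bdd_above (range (\<lambda>k. max (SW \<mu> (\<mu>s k)) (potential_energy V (\<mu>s k))))}"
    proof (rule Inf_greatest, clarify)
      fix \<mu>s assume \<mu>s: "\<forall>k. \<mu>s k \<in> P2" "narrowly_conv \<mu>s \<mu>"
      have "liminf (\<lambda>k. ?c (\<mu>s k)) \<le> liminf (\<lambda>k. ?s (\<mu>s k))"
        using SW_slope_ge \<mu>s(1) by (intro Liminf_mono always_eventually) blast
      then show "?c \<mu> \<le> liminf (\<lambda>k. ?s (\<mu>s k))" by (simp only: lim[OF \<mu>s(2)])
    qed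
  qed
qed

end

theorem corollary7p7:
  fixes V :: "real ^ 'n \<Rightarrow> real"
    and gradV :: "real ^ 'n \<Rightarrow> real ^ 'n"
    and \<mu> :: "(real ^ 'n) measure"
  assumes "CARD('n) \<ge> 2"
    and "\<And>x. GDERIV V x :> gradV x"
    and "continuous_on UNIV gradV"
    and "bounded (range gradV)"
    and "\<mu> \<in> P2"
  shows "relaxed_slope SW (potential_energy V) \<mu>
    = ennreal (sqrt (real CARD('n))) * metric_slope P2 W (potential_energy V) \<mu>"
proof -
  obtain L where "0 < L" "\<And>x. norm (gradV x) \<le> L"
    using assms(4) by (auto simp: bounded_pos)
  then interpret bounded_C1_potential V gradV L
    using assms by unfold_locales auto
  show ?thesis
    using relaxed_slope_eq[OF assms(5)] W_slope_eq[OF assms(5)] by (simp add: ennreal_mult)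
qed

end
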